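(* Let $N\ge2$. The hamiltonians $\mathbf H_n=\frac1n\int\operatorname{Tr}\operatorname{Res}\mathbf P^n$ ($n\ge1$) of the $N$th $q$-deformed mKdV hierarchy commute with the hamiltonian $$\mathbf H=\sum_{i=1}^N\int Q_i(w)Q_{i+1}(wq)^{-1}$$ of the $N$th $q$-deformed affine Toda equation: $\{\mathbf H_n,\mathbf H\}=0$ for all $n\ge1$.
   Context: $q\in\mathbb C^\times$ is generic (in particular not a root of unity), and $D$ is the $q$-shift $[D\cdot f](z)=f(zq)$, so $D\,f(z)=f(zq)\,D$ as operators. $\Lambda_i(z)=\sum_{m\in\mathbb Z}\Lambda_i[m]z^{-m}$, $i=1,\dots,N$, are formal Laurent series with independent coefficients; indices are taken modulo $N$. Ring $\mathcal J_{q,N}$: the smallest ring with $D$-action containing $\mathbb C[\Lambda_i(zq^j)]_{1\le i\le N,\,j\in\mathbb Z}$ on which $1+D+\dots+D^{N-1}$ is invertible. $\mathcal I_{q,N}$ is the ring of operators $\sum_{n\le M}J_nD^n$, $J_n\in\mathcal J_{q,N}$ (infinitely many negative powers allowed); $\operatorname{Res}\sum_nR_nD^n=R_0$ (entrywise on matrices). $L_i=(D-\Lambda_i(z))(D-\Lambda_{i+1}(z))\cdots(D-\Lambda_{i+N-1}(z))$; $P_i=(L_i)^{1/N}\in\mathcal I_{q,N}$ is the unique element of the form $D+\sum_{m\ge0}P_i^{[m]}D^{-m}$ with $P_i^N=L_i$; $\mathbf P=\operatorname{diag}(P_1,\dots,P_N)$. The series $Q_i(z)$ are formal solutions of $Q_i(zq)=\Lambda_i(z)Q_i(z)$,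 and $\mathcal J^+_{q,N}=\mathcal J_{q,N}\otimes\mathbb C[Q_1(z)^{\pm1},\dots,Q_N(z)^{\pm1}]$, with $D$ acting on the $Q_i$ by this relation. $\int R$ denotes the $0$th Fourier coefficient of $R$; $\mathcal G_{q,N}$ and $\mathcal G^+_{q,N}$ are the spans of $\int R$ for $R\in\mathcal J_{q,N}$, resp. $R\in\mathcal J^+_{q,N}$. The partial Poisson bracket $\{\cdot,\cdot\}:\mathcal G_{q,N}\times\mathcal G^+_{q,N}\to\mathcal G^+_{q,N}$ is determined by bilinearity and the Leibniz rule from $$\{\Lambda_i(z),Q_i(w)\}=-\sum_{m\in\mathbb Z}\Big(\frac wz\Big)^m\frac{1-q^{m(N-1)}}{1-q^{mN}}\Lambda_i(z)Q_i(w),$$ $$\{\Lambda_i(z),Q_j(w)\}=\sum_{m\in\mathbb Z}\Big(\frac{wq^{N+i-j-1}}{z}\Big)^m\frac{1-q^m}{1-q^{mN}}\Lambda_i(z)Q_j(w)\quad(1\le i<j\le N),$$ $$\{\Lambda_i(z),Q_j(w)\}=\sum_{m\in\mathbb Z}\Big(\frac{wq^{i-j-1}}{z}\Big)^m\frac{1-q^m}{1-q^{mN}}\Lambda_i(z)Q_j(w)\quad(1\le j<i\le N),$$ where $m=0$ coefficients are limiting values ($\frac{N-1}N$, $\frac1N$, $\frac1N$). With these, $\{\Lambda_i(z),\mathbf H\}=A_i(z)-A_{i+1}(zq)$, where $A_i(z)=Q_{i-1}(z)Q_i(z)^{-1}$; i.e. $\{\cdot,\mathbf H\}$ is the $q$-deformed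 affine Toda flow $\partial_t\Lambda_i(z)=A_i(z)-A_{i+1}(zq)$. *)

theory Defs
  imports Complex_Main "HOL-Library.Multiset" "HOL-Library.Poly_Mapping"
begin

section \<open>Formal power series in arbitrarily many variables\<close>

typedef (overloaded) ('v, 'a) mps = "UNIV :: ('v multiset \<Rightarrow> 'a) set"
  morphisms mcoeff Mps ..

setup_lifting type_definition_mps

lemma mcoeff_Mps [simp]: "mcoeff (Mps f) = f"
  by (simp add: Mps_inverse)

lemma mps_eqI: "(\<And>M. mcoeff f M = mcoeff g M) \<Longrightarrow> f = g"
  by (simp add: mcoeff_inject[symmetric] fun_eq_iff)

lemma finite_submsets [simp]: "finite {A. A \<subseteq># M}"
proof (induction M)
  case (add x M)
  have "{A. A \<subseteq># add_mset x M} \<subseteq> {A. A \<subseteq># M} \<union> add_mset x ` {A. A \<subseteq># M}"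
  proof
    fix A assume "A \<in> {A. A \<subseteq># add_mset x M}"
    then have A: "A \<subseteq># add_mset x M" by simp
    show "A \<in> {A. A \<subseteq># M} \<union> add_mset x ` {A. A \<subseteq># M}"
    proof (cases "x \<in># A")
      case True
      then obtain B where "A = add_mset x B" by (meson multi_member_split)
      with A show ?thesis by auto
    next
      case False
      have "A \<subseteq># M"
        using A False by (metis add_mset_remove_trivial diff_single_trivial subset_eq_diff_conv
            add_mset_add_single)
      then show ?thesis by simp
    qed
  qed
  then show ?case using add by (meson finite_UnI finite_imageI finite_subset)
qed simp

lemma diff_diff_submset: "A \<subseteq># M \<Longrightarrow> M - (M - A) = A"
  by (auto simp: multiset_eq_iff subseteq_mset_def)

instantiation mps :: (type, comm_ring_1) comm_ring_1
begin

lift_definition zero_mps :: "('a, 'b) mps" is "\<lambda>M. 0" .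
lift_definition one_mps :: "('a, 'b) mps" is "\<lambda>M. if M = {#} then 1 else 0" .
lift_definition plus_mps :: "('a, 'b) mps \<Rightarrow> ('a, 'b) mps \<Rightarrow> ('a, 'b) mps"
  is "\<lambda>f g M. f M + g M" .
lift_definition minus_mps :: "('a, 'b) mps \<Rightarrow> ('a, 'b) mps \<Rightarrow> ('a, 'b) mps"
  is "\<lambda>f g M. f M - g M" .
lift_definition uminus_mps :: "('a, 'b) mps \<Rightarrow> ('a, 'b) mps"
  is "\<lambda>f M. - f M" .
lift_definition times_mps :: "('a, 'b) mps \<Rightarrow> ('a, 'b) mps \<Rightarrow> ('a, 'b) mps"
  is "\<lambda>f g M. \<Sum>A\<in>{A. A \<subseteq># M}. f A * g (M - A)" .

instance
proof
  fix f g h :: "('a, 'b) mps"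
  show "f * g * h = f * (g * h)"
  proof (rule mps_eqI)
    fix M
    have "mcoeff (f * g * h) M =
        (\<Sum>A\<in>{A. A \<subseteq># M}. \<Sum>B\<in>{B. B \<subseteq># A}. mcoeff f B * mcoeff g (A - B) * mcoeff h (M - A))"
      by (simp add: times_mps.rep_eq sum_distrib_right)
    also have "\<dots> = (\<Sum>(A, B)\<in>(SIGMA A:{A. A \<subseteq># M}. {B. B \<subseteq># A}).
        mcoeff f B * mcoeff g (A - B) * mcoeff h (M - A))"
      by (rule sum.Sigma) auto
    also have "\<dots> = (\<Sum>(B, C)\<in>(SIGMA B:{B. B \<subseteq># M}. {C. C \<subseteq># M - B}).
        mcoeff f B * mcoeff g C * mcoeff h (M - B - C))"
    proof (rule sum.reindex_bij_witness[where i = "\<lambda>(B, C). (B + C, B)" and j = "\<lambda>(A, B). (B, A - B)"],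
        goal_cases)
      case (5 x)
      then obtain A B where x: "x = (A, B)" "A \<subseteq># M" "B \<subseteq># A" by auto
      then have "M - B - (A - B) = M - A"
        by (auto simp: multiset_eq_iff subseteq_mset_def)
      with x show ?case by simp
    next
      case (2 x)
      then show ?case
        by (auto simp: subseteq_mset_def intro: order_trans intro!: diff_le_mono)
    next
      case (4 x)
      then show ?case
        by (auto simp: subset_mset.le_diff_conv2 subseteq_mset_def le_diff_conv2 add.commute)
    qed (auto simp: subset_mset.add_diff_inverse)
    also have "\<dots> = (\<Sum>B\<in>{B. B \<subseteq># M}. \<Sum>C\<in>{C. C \<subseteq># M - B}.
        mcoeff f B * mcoeff g C * mcoeff h (M - B - C))"
      by (rule sum.Sigma[symmetric]) auto
    also have "\<dots> = mcoeff (f * (g * h)) M"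
      by (simp add: times_mps.rep_eq sum_distrib_left mult.assoc)
    finally show "mcoeff (f * g * h) M = mcoeff (f * (g * h)) M" .
  qed
  show "f * g = g * f"
  proof (rule mps_eqI)
    fix M
    show "mcoeff (f * g) M = mcoeff (g * f) M"
      unfolding times_mps.rep_eq
      by (rule sum.reindex_bij_witness[where i = "\<lambda>A. M - A" and j = "\<lambda>A. M - A"])
         (auto simp: mult.commute diff_diff_submset)
  qed
  show "1 * f = f"
  proof (rule mps_eqI)
    fix M
    have "mcoeff (1 * f) M = (\<Sum>A\<in>{A. A \<subseteq># M}. if A = {#} then mcoeff f M else 0)"
      unfolding times_mps.rep_eq one_mps.rep_eq by (intro sum.cong) auto
    then show "mcoeff (1 * f) M = mcoeff f M" by (simp add: sum.delta)
  qed
  show "(f + g) * h = f * h + g * h"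
    by (rule mps_eqI)
       (simp add: times_mps.rep_eq plus_mps.rep_eq algebra_simps sum.distrib)
  show "(0::('a, 'b) mps) \<noteq> 1"
    by (metis one_mps.rep_eq zero_mps.rep_eq zero_neq_one)
qed (rule mps_eqI, simp add: plus_mps.rep_eq minus_mps.rep_eq uminus_mps.rep_eq zero_mps.rep_eq algebra_simps)+

end


section \<open>Fourier series in the modes of the \<open>\<Lambda>\<^sub>i\<close>\<close>

text \<open>
  The coefficients \<open>\<Lambda>\<^sub>i[m]\<close> are independent variables.  The nonzero modes are the power series
  variables \<open>(i, m)\<close> of an \<^typ>\<open>('v, 'a) mps\<close> (the variables \<open>(i, 0)\<close> are never used); the zero modes
  \<open>\<Lambda>\<^sub>i[0]\<close> are invertible and live in the coefficient ring of Laurent polynomials, so that the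
  \<open>\<Lambda>\<^sub>i(z)\<close> are units.

  The coefficient of \<open>z ^ (- n)\<close> in a series built from the \<open>\<Lambda>\<^sub>i(z q ^ j)\<close> contains only
  monomials of total mode \<open>n\<close>.  Hence the power of \<open>z\<close> can be read off from the monomial, and a
  Fourier series is represented by the sum of its coefficients.
\<close>

type_synonym lpoly = "(nat \<Rightarrow>\<^sub>0 int) \<Rightarrow>\<^sub>0 complex"
type_synonym fser = "(nat \<times> int, lpoly) mps"

text \<open>The power of \<open>z\<close> that multiplies the monomial \<open>M\<close>.\<close>

definition zexp :: "(nat \<times> int) multiset \<Rightarrow> int" where
  "zexp M = - sum_mset (image_mset snd M)"

definition lconst :: "complex \<Rightarrow> lpoly" where
  "lconst c = Poly_Mapping.single 0 c"

definition fconst :: "complex \<Rightarrow> fser" where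
  "fconst c = Mps (\<lambda>M. if M = {#} then lconst c else 0)"

definition Lam :: "nat \<Rightarrow> fser" where
  "Lam i = Mps (\<lambda>M. if M = {#} then Poly_Mapping.single (Poly_Mapping.single i 1) 1
                    else if \<exists>m. m \<noteq> 0 \<and> M = {#(i, m)#} then 1 else 0)"

text \<open>The Fourier multiplier \<open>\<Sum>\<^sub>m f\<^sub>m z ^ m \<mapsto> \<Sum>\<^sub>m c m * f\<^sub>m z ^ m\<close>.\<close>

definition fmul :: "(int \<Rightarrow> complex) \<Rightarrow> fser \<Rightarrow> fser" where
  "fmul c f = Mps (\<lambda>M. lconst (c (zexp M)) * mcoeff f M)"

text \<open>\<open>shift q k f\<close> is \<open>f(z q ^ k)\<close>.\<close>

definition shift :: "complex \<Rightarrow> int \<Rightarrow> fser \<Rightarrow> fser" where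
  "shift q k = fmul (\<lambda>m. q powi (k * m))"

text \<open>The 0th Fourier coefficient.\<close>

definition fint :: "fser \<Rightarrow> fser" where
  "fint f = Mps (\<lambda>M. if zexp M = 0 then mcoeff f M else 0)"

text \<open>
  The operator \<open>1 + D + \<dots> + D ^ (N - 1)\<close> multiplies \<open>z ^ m\<close> by \<open>\<Sum>k<N. q powi (k * m)\<close>; for \<open>q\<close> not
  a root of unity it is bijective on all Fourier series.  The rules \<open>J_unshift\<close> and
  \<open>J_divide\<close> therefore close \<open>J\<close> under its inverse and under \<open>D\<^sup>-\<^sup>1\<close>.
\<close>

inductive_set J :: "complex \<Rightarrow> nat \<Rightarrow> fser set" for q :: complex and N :: nat where
  J_const: "fconst c \<in> J q N"
| J_Lam: "1 \<le> i \<Longrightarrow> i \<le> N \<Longrightarrow> Lam i \<in> J q N"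
| J_add: "f \<in> J q N \<Longrightarrow> g \<in> J q N \<Longrightarrow> f + g \<in> J q N"
| J_mult: "f \<in> J q N \<Longrightarrow> g \<in> J q N \<Longrightarrow> f * g \<in> J q N"
| J_shift: "f \<in> J q N \<Longrightarrow> shift q 1 f \<in> J q N"
| J_unshift: "shift q 1 f \<in> J q N \<Longrightarrow> f \<in> J q N"
| J_divide: "(\<Sum>k<N. shift q (int k) f) \<in> J q N \<Longrightarrow> f \<in> J q N"


section \<open>Difference operators\<close>

text \<open>\<open>A :: dop\<close> stands for \<open>\<Sum>\<^sub>n A\<^sub>n D ^ n\<close>.\<close>

type_synonym dop = "int \<Rightarrow> fser"

definition Iop :: "complex \<Rightarrow> nat \<Rightarrow> dop set" where
  "Iop q N = {A. (\<forall>n. A n \<in> J q N) \<and> (\<exists>M. \<forall>n>M. A n = 0)}"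

text \<open>The index set below is finite for operators whose order is bounded above.\<close>

definition dmult :: "complex \<Rightarrow> dop \<Rightarrow> dop \<Rightarrow> dop" where
  "dmult q A B = (\<lambda>n. \<Sum>k | A k \<noteq> 0 \<and> B (n - k) \<noteq> 0. A k * shift q k (B (n - k)))"

definition opone :: dop where
  "opone = (\<lambda>n. if n = 0 then 1 else 0)"

primrec dpow :: "complex \<Rightarrow> dop \<Rightarrow> nat \<Rightarrow> dop" where
  "dpow q A 0 = opone"
| "dpow q A (Suc n) = dmult q A (dpow q A n)"

definition Res :: "dop \<Rightarrow> fser" where
  "Res A = A 0"

text \<open>Representative in \<open>{1..N}\<close> of an index modulo \<open>N\<close>.\<close>

definition wrap :: "nat \<Rightarrow> nat \<Rightarrow> nat" where
  "wrap N i = (i + N - 1) mod N + 1"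

text \<open>The operator \<open>D - \<Lambda>\<^sub>i(z)\<close>.\<close>

definition Dminus :: "nat \<Rightarrow> dop" where
  "Dminus i = (\<lambda>n. if n = 1 then 1 else if n = 0 then - Lam i else 0)"

definition Lop :: "complex \<Rightarrow> nat \<Rightarrow> nat \<Rightarrow> dop" where
  "Lop q N i = foldr (dmult q) (map (\<lambda>k. Dminus (wrap N (i + k))) [0..<N]) opone"

definition Pop :: "complex \<Rightarrow> nat \<Rightarrow> nat \<Rightarrow> dop" where
  "Pop q N i = (THE P. P \<in> Iop q N \<and> P 1 = 1 \<and> (\<forall>n>1. P n = 0) \<and> dpow q P N = Lop q N i)"

text \<open>Matrices of operators, with rows and columns indexed by \<open>{1..N}\<close>.\<close>

type_synonym dmat = "nat \<Rightarrow> nat \<Rightarrow> dop"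

definition diagm :: "(nat \<Rightarrow> dop) \<Rightarrow> dmat" where
  "diagm d = (\<lambda>i j. if i = j then d i else (\<lambda>n. 0))"

definition mmult :: "complex \<Rightarrow> nat \<Rightarrow> dmat \<Rightarrow> dmat \<Rightarrow> dmat" where
  "mmult q N A B = (\<lambda>i j n. \<Sum>l=1..N. dmult q (A i l) (B l j) n)"

primrec mpow :: "complex \<Rightarrow> nat \<Rightarrow> dmat \<Rightarrow> nat \<Rightarrow> dmat" where
  "mpow q N A 0 = diagm (\<lambda>i. opone)"
| "mpow q N A (Suc n) = mmult q N A (mpow q N A n)"

definition Tr :: "nat \<Rightarrow> (nat \<Rightarrow> nat \<Rightarrow> fser) \<Rightarrow> fser" where
  "Tr N A = (\<Sum>i=1..N. A i i)"

definition Hn :: "complex \<Rightarrow> nat \<Rightarrow> nat \<Rightarrow> fser" where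
  "Hn q N n = fconst (1 / of_nat n) *
     fint (Tr N (\<lambda>i j. Res (mpow q N (diagm (Pop q N)) n i j)))"


section \<open>Series in the \<open>Q\<^sub>i\<close>\<close>

text \<open>\<open>Poly_Mapping.single \<alpha> f\<close> stands for \<open>f(z) \<Prod>\<^sub>i Q\<^sub>i(z) ^ \<alpha>\<^sub>i\<close>.\<close>

type_synonym qser = "(nat \<Rightarrow>\<^sub>0 int) \<Rightarrow>\<^sub>0 fser"

definition emb :: "fser \<Rightarrow> qser" where
  "emb f = Poly_Mapping.single 0 f"

definition Qpow :: "nat \<Rightarrow> int \<Rightarrow> qser" where
  "Qpow i a = Poly_Mapping.single (Poly_Mapping.single i a) 1"

definition minv :: "fser \<Rightarrow> fser" where
  "minv f = (THE g. f * g = 1)"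

lemma zexp_simps [simp]: "zexp {#} = 0" "zexp (add_mset x M) = zexp M - snd x"
  by (auto simp: zexp_def)

lemma mcoeff_power_eq_0:
  fixes g :: "('v, 'a::comm_ring_1) mps"
  assumes "mcoeff g {#} = 0" "size M < k"
  shows "mcoeff (g ^ k) M = 0"
  using assms(2)
proof (induction k arbitrary: M)
  case (Suc k)
  have "mcoeff g A * mcoeff (g ^ k) (M - A) = 0" if "A \<subseteq># M" for A
  proof (cases "A = {#}")
    case False
    then have "0 < size A" by (simp add: nonempty_has_size)
    then have "size (M - A) < k"
      using Suc.prems size_mset_mono[OF that] by (simp add: size_Diff_submset[OF that])
    then show ?thesis by (simp add: Suc.IH)
  qed (simp add: assms)
  then show ?case by (simp add: times_mps.rep_eq)
qed simp

lemma mps_unit: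
  fixes f :: "('v, 'a::comm_ring_1) mps"
  assumes "u * mcoeff f {#} = 1"
  shows "\<exists>h. f * h = 1"
proof -
  define c :: "('v, 'a) mps" where "c = Mps (\<lambda>M. if M = {#} then u else 0)"
  define g where "g = 1 - c * f"
  define h where "h = Mps (\<lambda>M. \<Sum>k\<le>size M. mcoeff (g ^ k) M)"
  have mcoeff_sum: "mcoeff (sum p A) M = (\<Sum>k\<in>A. mcoeff (p k) M)"
    for p :: "nat \<Rightarrow> ('v, 'a) mps" and A M
    by (induction A rule: infinite_finite_induct) (auto simp: zero_mps.rep_eq plus_mps.rep_eq)
  have g0: "mcoeff g {#} = 0"
    using assms by (simp add: g_def c_def minus_mps.rep_eq one_mps.rep_eq times_mps.rep_eq)
  have "h * (1 - g) = 1"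
  proof (rule mps_eqI)
    fix M :: "'v multiset"
    let ?s = "\<Sum>k<Suc (size M). g ^ k"
    have "mcoeff h A = mcoeff ?s A" if "A \<subseteq># M" for A
    proof -
      have "mcoeff ?s A = (\<Sum>k<Suc (size M). mcoeff (g ^ k) A)"
        by (rule mcoeff_sum)
      also have "\<dots> = (\<Sum>k\<le>size A. mcoeff (g ^ k) A)"
        using size_mset_mono[OF that] g0 by (intro sum.mono_neutral_right) (auto simp: mcoeff_power_eq_0)
      finally show ?thesis by (simp add: h_def)
    qed
    then have "mcoeff (h * (1 - g)) M = mcoeff (?s * (1 - g)) M"
      by (simp add: times_mps.rep_eq del: sum.lessThan_Suc)
    also have "?s * (1 - g) = 1 - g ^ Suc (size M)"
      by (metis one_diff_power_eq mult.commute)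
    also have "mcoeff \<dots> M = mcoeff 1 M"
      using mcoeff_power_eq_0[OF g0, of M "Suc (size M)"] by (simp add: minus_mps.rep_eq)
    finally show "mcoeff (h * (1 - g)) M = mcoeff 1 M" .
  qed
  then have "f * (c * h) = 1" by (simp add: g_def algebra_simps)
  then show ?thesis by blast
qed

lemma minv_Lam: "Lam i * minv (Lam i) = 1"
proof -
  have "Poly_Mapping.single (Poly_Mapping.single i (- 1)) 1 * mcoeff (Lam i) {#} = 1"
    by (simp add: Lam_def mult_single flip: single_add)
  then obtain h where h: "Lam i * h = 1" using mps_unit by blast
  show ?thesis unfolding minv_def
  proof (rule theI)
    fix g assume g: "Lam i * g = 1"
    have "g = (Lam i * h) * g" by (simp add: h)
    also have "\<dots> = (Lam i * g) * h" by (simp add: mult_ac)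
    finally show "g = h" by (simp add: g)
  qed (rule h)
qed

definition Lampow :: "(nat \<Rightarrow>\<^sub>0 int) \<Rightarrow> fser" where
  "Lampow \<alpha> = (\<Prod>i\<in>Poly_Mapping.keys \<alpha>.
     if 0 \<le> Poly_Mapping.lookup \<alpha> i then Lam i ^ nat (Poly_Mapping.lookup \<alpha> i)
     else minv (Lam i) ^ nat (- Poly_Mapping.lookup \<alpha> i))"

text \<open>The action of \<open>D\<close>, which sends \<open>Q\<^sub>i\<close> to \<open>\<Lambda>\<^sub>i Q\<^sub>i\<close>.\<close>

definition qshift :: "complex \<Rightarrow> qser \<Rightarrow> qser" where
  "qshift q = Poly_Mapping.mapp (\<lambda>\<alpha> f. shift q 1 f * Lampow \<alpha>)"

text \<open>
  Since \<open>D Q\<^sub>i\<^sup>-\<^sup>1 = \<Lambda>\<^sub>i\<^sup>-\<^sup>1 Q\<^sub>i\<^sup>-\<^sup>1\<close>, stability under \<open>D\<close> forces the inverses of the \<open>\<Lambda>\<^sub>i(z q ^ j)\<close>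
  into the coefficients of \<open>Jplus\<close>.
\<close>

inductive_set Jplus :: "complex \<Rightarrow> nat \<Rightarrow> qser set" for q :: complex and N :: nat where
  Jplus_emb: "f \<in> J q N \<Longrightarrow> emb f \<in> Jplus q N"
| Jplus_Q: "1 \<le> i \<Longrightarrow> i \<le> N \<Longrightarrow> Qpow i a \<in> Jplus q N"
| Jplus_add: "X \<in> Jplus q N \<Longrightarrow> Y \<in> Jplus q N \<Longrightarrow> X + Y \<in> Jplus q N"
| Jplus_mult: "X \<in> Jplus q N \<Longrightarrow> Y \<in> Jplus q N \<Longrightarrow> X * Y \<in> Jplus q N"
| Jplus_shift: "X \<in> Jplus q N \<Longrightarrow> qshift q X \<in> Jplus q N"
| Jplus_unshift: "qshift q X \<in> Jplus q N \<Longrightarrow> X \<in> Jplus q N"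

text \<open>
  The \<open>Q\<^sub>i(z)\<close> are only formal solutions of a difference equation and have no Fourier expansion of
  their own.  The formal 0th coefficient of a series containing them is its class modulo the total
  differences \<open>D T - T\<close>.  For series without \<open>Q\<^sub>i\<close> this is the 0th Fourier coefficient
  (lemma \<open>qint_emb_eq_iff\<close>).
\<close>

definition qint :: "complex \<Rightarrow> qser \<Rightarrow> qser set" where
  "qint q X = {X + (qshift q T - T) | T. True}"

lemma lconst_1: "lconst 1 = 1"
  by (simp add: lconst_def)

lemma lconst_diff: "lconst (a - b) = lconst a - lconst b"
  by (simp add: lconst_def single_diff)

lemma lconst_mult: "lconst a * lconst b = lconst (a * b)"
  by (simp add: lconst_def mult_single)

lemma shift_0: "shift q k 0 = 0"
  by (rule mps_eqI) (simp add: shift_def fmul_def zero_mps.rep_eq)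

lemma shift_add: "shift q k (f + g) = shift q k f + shift q k g"
  by (rule mps_eqI) (simp add: shift_def fmul_def plus_mps.rep_eq algebra_simps)

lemma lookup_qshift:
  "Poly_Mapping.lookup (qshift q X) \<alpha> = shift q 1 (Poly_Mapping.lookup X \<alpha>) * Lampow \<alpha>"
  by (simp add: qshift_def lookup_mapp in_keys_iff shift_0 when_def)

lemma qshift_add: "qshift q (X + Y) = qshift q X + qshift q Y"
  by (rule poly_mapping_eqI) (simp add: lookup_qshift lookup_add shift_add algebra_simps)

lemma qshift_diff: "qshift q (X - Y) = qshift q X - qshift q Y"
  by (metis qshift_add add_diff_cancel diff_add_cancel)

lemma qint_emb_eq_iff:
  assumes "q \<noteq> 0" "\<And>k::nat. 1 \<le> k \<Longrightarrow> q ^ k \<noteq> 1"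
  shows "qint q (emb f) = qint q (emb g) \<longleftrightarrow> fint f = fint g"
proof
  assume "qint q (emb f) = qint q (emb g)"
  moreover have "emb f \<in> qint q (emb f)"
    unfolding qint_def by (rule CollectI, rule exI[of _ 0]) 
      (simp add: poly_mapping_eq_iff fun_eq_iff lookup_qshift lookup_add lookup_minus shift_0)
  ultimately obtain T where T: "emb f = emb g + (qshift q T - T)" by (auto simp: qint_def)
  have "f = g + (shift q 1 (Poly_Mapping.lookup T 0) - Poly_Mapping.lookup T 0)"
    using arg_cong[OF T, of "\<lambda>X. Poly_Mapping.lookup X 0"]
    by (auto simp: emb_def lookup_add lookup_minus lookup_qshift Lampow_def shift_0)
  then show "fint f = fint g"
    by (auto intro!: mps_eqI simp: fint_def plus_mps.rep_eq minus_mps.rep_eq shift_def fmul_def lconst_1)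
next
  assume eq: "fint f = fint g"
  define t where "t = fmul (\<lambda>m. 1 / (q powi m - 1)) (f - g)"
  have q: "q powi m \<noteq> 1" if "m \<noteq> 0" for m
  proof
    assume 1: "q powi m = 1"
    then have "q ^ nat \<bar>m\<bar> = 1"
      by (cases "0 \<le> m") (auto simp: power_int_def power_inverse)
    moreover have "1 \<le> nat \<bar>m\<bar>" using that by linarith
    ultimately show False using assms(2) by blast
  qed
  have "shift q 1 t - t = f - g"
  proof (rule mps_eqI)
    fix M
    show "mcoeff (shift q 1 t - t) M = mcoeff (f - g) M"
    proof (cases "zexp M = 0")
      case True
      then have "mcoeff f M = mcoeff g M" using arg_cong[OF eq, of "\<lambda>h. mcoeff h M"] by (simp add: fint_def)
      then show ?thesis by (simp add: t_def shift_def fmul_def minus_mps.rep_eq)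
    next
      case False
      let ?r = "q powi zexp M"
      have "mcoeff (shift q 1 t - t) M = (lconst ?r - 1) * (lconst (1 / (?r - 1)) * mcoeff (f - g) M)"
        by (simp add: t_def shift_def fmul_def minus_mps.rep_eq algebra_simps)
      also have "\<dots> = (lconst (?r - 1) * lconst (1 / (?r - 1))) * mcoeff (f - g) M"
        by (simp add: lconst_diff lconst_1 mult.assoc)
      also have "lconst (?r - 1) * lconst (1 / (?r - 1)) = 1"
        using q[OF False] by (simp add: lconst_mult lconst_1)
      finally show ?thesis by simp
    qed
  qed
  then have *: "emb f = emb g + (qshift q (emb t) - emb t)"
    by (intro poly_mapping_eqI)
       (auto simp: emb_def lookup_add lookup_minus lookup_qshift Lampow_def shift_0
          lookup_single when_def algebra_simps)
  show "qint q (emb f) = qint q (emb g)"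
    unfolding qint_def
  proof safe
    fix T
    show "\<exists>S. emb f + (qshift q T - T) = emb g + (qshift q S - S) \<and> True"
      by (rule exI[of _ "T + emb t"]) (simp add: * qshift_add)
    show "\<exists>S. emb g + (qshift q T - T) = emb f + (qshift q S - S) \<and> True"
      by (rule exI[of _ "T - emb t"]) (simp add: * qshift_diff)
  qed
qed


section \<open>The partial Poisson bracket\<close>

text \<open>The derivative with respect to the zero mode \<open>\<Lambda>\<^sub>i[0]\<close> of a Laurent polynomial.\<close>

definition lderiv :: "nat \<Rightarrow> lpoly \<Rightarrow> lpoly" where
  "lderiv i p = (\<Sum>\<beta>\<in>Poly_Mapping.keys p.
     Poly_Mapping.single (\<beta> - Poly_Mapping.single i 1)
       (of_int (Poly_Mapping.lookup \<beta> i) * Poly_Mapping.lookup p \<beta>))"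

text \<open>The partial derivative with respect to \<open>\<Lambda>\<^sub>i[m]\<close>.\<close>

definition pderiv_mode :: "nat \<Rightarrow> int \<Rightarrow> fser \<Rightarrow> fser" where
  "pderiv_mode i m f = Mps (\<lambda>M. if m = 0 then lderiv i (mcoeff f M)
     else of_nat (Suc (count M (i, m))) * mcoeff f (add_mset (i, m) M))"

text \<open>
  \<open>vder i F\<close> is the series \<open>\<Sum>\<^sub>n (\<partial>F / \<partial>\<Lambda>\<^sub>i[n]) z ^ n\<close>.  As \<open>F\<close> is a 0th Fourier coefficient, the
  monomials of \<open>\<partial>F / \<partial>\<Lambda>\<^sub>i[n]\<close> have total mode \<open>- n\<close>.
\<close>

definition vder :: "nat \<Rightarrow> fser \<Rightarrow> fser" where
  "vder i F = Mps (\<lambda>M. mcoeff (pderiv_mode i (zexp M) F) M)"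

text \<open>
  The structure constants of the bracket:
  \<open>{\<Lambda>\<^sub>i(z), Q\<^sub>j(w)} = \<Sum>\<^sub>m kern q N i j m * (w / z) ^ m * \<Lambda>\<^sub>i(z) Q\<^sub>j(w)\<close>.
\<close>

definition kern :: "complex \<Rightarrow> nat \<Rightarrow> nat \<Rightarrow> nat \<Rightarrow> int \<Rightarrow> complex" where
  "kern q N i j m =
     (if i = j then
        - (if m = 0 then (of_nat N - 1) / of_nat N
           else (1 - q powi (m * (int N - 1))) / (1 - q powi (m * int N)))
      else
        (if i < j then q powi (m * (int N + int i - int j - 1))
         else q powi (m * (int i - int j - 1))) *
        (if m = 0 then 1 / of_nat N
         else (1 - q powi m) / (1 - q powi (m * int N))))"

text \<open>
  By the Leibniz rule in the first argument,
  \<open>{F, Q\<^sub>j(w)} = \<Sum>\<^sub>i \<Sum>\<^sub>n (\<partial>F / \<partial>\<Lambda>\<^sub>i[n]) {\<Lambda>\<^sub>i[n], Q\<^sub>j(w)}\<close>, which is the 0th coefficient in \<open>z\<close> of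
  \<open>\<Sum>\<^sub>i vder i F (z) {\<Lambda>\<^sub>i(z), Q\<^sub>j(w)}\<close>.  This is \<open>Qrate q N F j (w) * Q\<^sub>j(w)\<close>, because the 0th
  coefficient of \<open>(w / z) ^ m * f(z)\<close> is \<open>f\<^sub>m w ^ m\<close>, with \<open>f\<^sub>m\<close> the coefficient of \<open>z ^ m\<close>.
\<close>

definition Qrate :: "complex \<Rightarrow> nat \<Rightarrow> fser \<Rightarrow> nat \<Rightarrow> fser" where
  "Qrate q N F j = (\<Sum>i=1..N. fmul (kern q N i j) (vder i F * Lam i))"

text \<open>\<open>{F, \<Lambda>\<^sub>j(w)}\<close>, from \<open>\<Lambda>\<^sub>j(w) = Q\<^sub>j(w q) Q\<^sub>j(w)\<^sup>-\<^sup>1\<close>.\<close>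

definition Lamrate :: "complex \<Rightarrow> nat \<Rightarrow> fser \<Rightarrow> nat \<Rightarrow> fser" where
  "Lamrate q N F j = Lam j * (shift q 1 (Qrate q N F j) - Qrate q N F j)"

text \<open>
  The derivation \<open>\<Sum>\<^sub>j \<Sum>\<^sub>p (\<partial>f / \<partial>\<Lambda>\<^sub>j[p]) g\<^sub>j[p]\<close>, where \<open>g\<^sub>j[p]\<close> is the coefficient of \<open>z ^ (- p)\<close>
  in \<open>g j\<close>; a monomial \<open>B\<close> occurs only in the \<open>g\<^sub>j[p]\<close> with \<open>p = - zexp B\<close>.
\<close>

definition evol :: "nat \<Rightarrow> (nat \<Rightarrow> fser) \<Rightarrow> fser \<Rightarrow> fser" where
  "evol N g f = Mps (\<lambda>M. \<Sum>j=1..N. \<Sum>B\<in>{B. B \<subseteq># M}.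
     mcoeff (pderiv_mode j (- zexp B) f) (M - B) * mcoeff (g j) B)"

text \<open>\<open>{F, X(w)}\<close> for a density \<open>X\<close>, by the Leibniz rule in the second argument.\<close>

definition hamder :: "complex \<Rightarrow> nat \<Rightarrow> fser \<Rightarrow> qser \<Rightarrow> qser" where
  "hamder q N F = Poly_Mapping.mapp (\<lambda>\<alpha> f. evol N (Lamrate q N F) f +
     (\<Sum>j=1..N. of_int (Poly_Mapping.lookup \<alpha> j) * Qrate q N F j) * f)"

lemma lderiv_simps [simp]: "lderiv i 0 = 0" "lderiv i 1 = 0"
  "lderiv i (Poly_Mapping.single (Poly_Mapping.single j 1) 1) = (if i = j then 1 else 0)"
  by (auto simp: lderiv_def keys_one lookup_single when_def)

lemma pderiv_mode_1: "pderiv_mode i m 1 = 0"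
  by (rule mps_eqI) (auto simp: pderiv_mode_def one_mps.rep_eq zero_mps.rep_eq)

lemma pderiv_mode_Lam: "pderiv_mode i m (Lam j) = (if i = j then 1 else 0)"
  by (rule mps_eqI) (auto simp: pderiv_mode_def Lam_def one_mps.rep_eq zero_mps.rep_eq)

lemma evol_Lam:
  assumes "1 \<le> j" "j \<le> N"
  shows "evol N g (Lam j) = g j"
proof (rule mps_eqI)
  fix M
  have "(\<Sum>B\<in>{B. B \<subseteq># M}. mcoeff (pderiv_mode i (- zexp B) (Lam j)) (M - B) * mcoeff (g i) B) =
      (if i = j then mcoeff (g j) M else 0)" for i
  proof (cases "i = j")
    case True
    have "mcoeff (1::fser) (M - B) * mcoeff (g j) B = (if B = M then mcoeff (g j) M else 0)"
      if "B \<subseteq># M" for B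
      using that by (auto simp: one_mps.rep_eq Diff_eq_empty_iff_mset)
    then show ?thesis using True by (simp add: pderiv_mode_Lam)
  qed (simp add: pderiv_mode_Lam zero_mps.rep_eq)
  then show "mcoeff (evol N g (Lam j)) M = mcoeff (g j) M"
    using assms by (simp add: evol_def)
qed

text \<open>The values of the bracket on the generators:\<close>

lemma hamder_Lam:
  assumes "1 \<le> j" "j \<le> N"
  shows "hamder q N F (emb (Lam j)) = emb (Lamrate q N F j)"
  by (rule poly_mapping_eqI)
     (use assms in \<open>auto simp: hamder_def lookup_mapp emb_def in_keys_iff lookup_single when_def evol_Lam Lamrate_def\<close>)

lemma hamder_Q:
  assumes "1 \<le> j" "j \<le> N"
  shows "hamder q N F (Qpow j 1) = emb (Qrate q N F j) * Qpow j 1"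
proof -
  have "evol N g 1 = 0" for g
    by (rule mps_eqI) (simp add: evol_def pderiv_mode_1 zero_mps.rep_eq)
  moreover have "(\<Sum>k=1..N. of_int (Poly_Mapping.lookup (Poly_Mapping.single j 1) k) * Qrate q N F k) =
      (\<Sum>k=1..N. if k = j then Qrate q N F j else 0)"
    by (intro sum.cong) (auto simp: lookup_single when_def)
  ultimately show ?thesis
    using assms
    by (intro poly_mapping_eqI)
       (auto simp: hamder_def lookup_mapp emb_def Qpow_def mult_single in_keys_iff lookup_single when_def)
qed

definition G :: "complex \<Rightarrow> nat \<Rightarrow> fser set" where
  "G q N = fint ` J q N"

definition Gplus :: "complex \<Rightarrow> nat \<Rightarrow> qser set set" where
  "Gplus q N = qint q ` Jplus q N"

text \<open>
  The bracket \<open>G \<times> Gplus \<rightarrow> Gplus\<close>, with \<open>{F, \<integral>X} = \<integral>{F, X}\<close>.  The union runs over all densities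
  \<open>X \<in> Jplus\<close> of the same element of \<open>Gplus\<close>.
\<close>

definition bracket :: "complex \<Rightarrow> nat \<Rightarrow> fser \<Rightarrow> qser set \<Rightarrow> qser set" where
  "bracket q N F C = (\<Union>X\<in>{X \<in> Jplus q N. qint q X = C}. qint q (hamder q N F X))"

definition Htoda :: "complex \<Rightarrow> nat \<Rightarrow> qser set" where
  "Htoda q N = qint q (\<Sum>i=1..N. Qpow i 1 * qshift q (Qpow (wrap N (i + 1)) (- 1)))"

end

theory Submission
  imports Defs
begin

text \<open>
  Write \<open>X\<^sub>i = D - \<Lambda>\<^sub>i\<close>.  Conjugation by \<open>X\<^sub>i\<close> rotates the factors of \<open>L\<^sub>i\<close>, so \<open>P\<^sub>i X\<^sub>i = X\<^sub>i P\<^sub>i\<^sub>+\<^sub>1\<close> by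
  uniqueness of monic roots, and the trace property \<open>\<integral>Res AB = \<integral>Res BA\<close> gives
  \<open>V\<^sub>i := \<delta>H\<^sub>n / \<delta>\<Lambda>\<^sub>i = - Res (X\<^sub>i\<^sup>-\<^sup>1 P\<^sub>i\<^sup>n)\<close>.

  On the other side, Hamiltonian flows commute with \<open>D\<close>, so the bracket with \<open>H\<close> may be computed on
  the density \<open>\<Sum>\<^sub>i \<Lambda>\<^sub>i\<^sub>+\<^sub>1\<^sup>-\<^sup>1 Q\<^sub>i Q\<^sub>i\<^sub>+\<^sub>1\<^sup>-\<^sup>1\<close>.  The structure constants telescope, and the result is
  \<open>\<Sum>\<^sub>i (V\<^sub>i\<^sub>+\<^sub>1 \<Lambda>\<^sub>i\<^sub>+\<^sub>1 - V\<^sub>i \<Lambda>\<^sub>i) \<Lambda>\<^sub>i\<^sub>+\<^sub>1\<^sup>-\<^sup>1 Q\<^sub>i Q\<^sub>i\<^sub>+\<^sub>1\<^sup>-\<^sup>1\<close>.  With \<open>C = X\<^sub>i\<^sub>+\<^sub>1\<^sup>-\<^sup>1 P\<^sub>i\<^sub>+\<^sub>1\<^sup>n X\<^sub>i\<^sup>-\<^sup>1\<close> one has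
  \<open>X\<^sub>i\<^sup>-\<^sup>1 P\<^sub>i\<^sup>n = X\<^sub>i\<^sub>+\<^sub>1 C\<close> and \<open>X\<^sub>i\<^sub>+\<^sub>1\<^sup>-\<^sup>1 P\<^sub>i\<^sub>+\<^sub>1\<^sup>n = C X\<^sub>i\<close>, and comparing the coefficients of \<open>D\<^sup>0\<close> shows that the
  \<open>i\<close>-th summand is \<open>D T - T\<close> for \<open>T = C\<^sub>-\<^sub>1 Q\<^sub>i Q\<^sub>i\<^sub>+\<^sub>1\<^sup>-\<^sup>1\<close>.
\<close>

section \<open>Derivations of Fourier series\<close>

lemma mcoeff_sum: "mcoeff (sum f S) M = (\<Sum>k\<in>S. mcoeff (f k) M)"
  by (induction S rule: infinite_finite_induct) (auto simp: zero_mps.rep_eq plus_mps.rep_eq)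

lemma mcoeff_fmul: "mcoeff (fmul c f) M = lconst (c (zexp M)) * mcoeff f M"
  by (simp add: fmul_def)

lemma mcoeff_shift: "mcoeff (shift q k f) M = lconst (q powi (k * zexp M)) * mcoeff f M"
  by (simp add: shift_def mcoeff_fmul)

lemma zexp_add: "zexp (A + B) = zexp A + zexp B"
  by (simp add: zexp_def)

lemma zexp_diff: "A \<subseteq># M \<Longrightarrow> zexp (M - A) = zexp M - zexp A"
  using zexp_add[of "M - A" A] by simp

lemma mcoeff_times_swap: "mcoeff (f * g) M = (\<Sum>B\<in>{B. B \<subseteq># M}. mcoeff f (M - B) * mcoeff g B)"
  unfolding times_mps.rep_eq
  by (rule sum.reindex_bij_witness[where i = "\<lambda>A. M - A" and j = "\<lambda>A. M - A"])
     (auto simp: diff_diff_submset)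

lemma lconst_sum: "lconst (sum f S) = (\<Sum>k\<in>S. lconst (f k))"
  by (induction S rule: infinite_finite_induct) (auto simp: lconst_def single_add)

lemma shift_one: "shift q k 1 = 1"
  by (rule mps_eqI) (auto simp: mcoeff_shift one_mps.rep_eq lconst_1)

lemma shift_diff: "shift q k (f - g) = shift q k f - shift q k g"
  by (rule mps_eqI) (simp add: mcoeff_shift minus_mps.rep_eq algebra_simps)

lemma shift_sum: "shift q k (sum f S) = (\<Sum>x\<in>S. shift q k (f x))"
  by (induction S rule: infinite_finite_induct) (auto simp: shift_0 shift_add)

lemma shift_zero_int: "shift q 0 f = f"
  by (rule mps_eqI) (simp add: mcoeff_shift lconst_1)

lemma shift_shift: "q \<noteq> 0 \<Longrightarrow> shift q k (shift q l f) = shift q (k + l) f"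
  by (rule mps_eqI) (simp add: mcoeff_shift mult.assoc[symmetric] lconst_mult
      power_int_add[symmetric] distrib_right)

text \<open>Rests on the additivity of \<open>zexp\<close>; \<open>q \<noteq> 0\<close> lets integer
  powers of \<open>q\<close> turn sums of exponents into products.\<close>

lemma shift_mult:
  assumes "q \<noteq> 0"
  shows "shift q k (f * g) = shift q k f * shift q k g"
proof (rule mps_eqI)
  fix M
  have "lconst (q powi (k * zexp M)) * (mcoeff f A * mcoeff g (M - A)) =
     (lconst (q powi (k * zexp A)) * mcoeff f A) * (lconst (q powi (k * zexp (M - A))) * mcoeff g (M - A))"
    if "A \<subseteq># M" for A
  proof -
    have "q powi (k * zexp M) = q powi (k * zexp A) * q powi (k * zexp (M - A))"
      using assms by (simp add: power_int_add[symmetric] zexp_diff[OF that] distrib_left[symmetric])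
    then show ?thesis by (simp add: lconst_mult[symmetric] mult_ac)
  qed
  then show "mcoeff (shift q k (f * g)) M = mcoeff (shift q k f * shift q k g) M"
    unfolding mcoeff_shift times_mps.rep_eq sum_distrib_left
    by (intro sum.cong) (simp_all add: mult_ac)
qed

lemma fint_shift: "fint (shift q k f) = fint f"
  by (rule mps_eqI) (simp add: fint_def mcoeff_shift lconst_1)

lemma fint_add: "fint (f + g) = fint f + fint g"
  by (rule mps_eqI) (simp add: fint_def plus_mps.rep_eq)

lemma fint_zero: "fint 0 = 0"
  by (rule mps_eqI) (simp add: fint_def zero_mps.rep_eq)

lemma fint_uminus: "fint (- f) = - fint f"
  by (rule mps_eqI) (simp add: fint_def uminus_mps.rep_eq)

lemma fint_sum: "fint (sum f S) = (\<Sum>x\<in>S. fint (f x))"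
  by (induction S rule: infinite_finite_induct) (auto simp: fint_zero fint_add)

lemma fconst_mult_mcoeff: "mcoeff (fconst c * f) M = lconst c * mcoeff f M"
proof -
  have "mcoeff (fconst c * f) M = (\<Sum>A\<in>{A. A \<subseteq># M}. if A = {#} then lconst c * mcoeff f M else 0)"
    unfolding times_mps.rep_eq fconst_def by (intro sum.cong) auto
  then show ?thesis by simp
qed

lemma fint_fconst: "fint (fconst c * f) = fconst c * fint f"
  by (rule mps_eqI) (simp add: fint_def fconst_mult_mcoeff)

text \<open>Testing against the monomial of opposite mode isolates each coefficient.\<close>

lemma fint_pairing_nondegenerate:
  assumes "\<And>g. fint (f * g) = 0"
  shows "f = 0"
proof (rule mps_eqI)
  fix A
  \<comment> \<open>One variable suffices: \<open>fser\<close> has variables of every mode, so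
    \<open>B\<close> can carry the exponent opposite to that of \<open>A\<close>.\<close>
  define B :: "(nat \<times> int) multiset" where "B = {#(0, zexp A)#}"
  define g :: fser where "g = Mps (\<lambda>M. if M = B then 1 else 0)"
  have "mcoeff (f * g) (A + B) = (\<Sum>C\<in>{C. C \<subseteq># A + B}. if C = B then mcoeff f A else 0)"
    unfolding mcoeff_times_swap by (intro sum.cong) (auto simp: g_def)
  also have "\<dots> = mcoeff f A" by simp
  finally have "mcoeff (f * g) (A + B) = mcoeff f A" .
  moreover have "zexp (A + B) = 0" by (simp add: zexp_add B_def)
  ultimately have "mcoeff f A = mcoeff (fint (f * g)) (A + B)" by (simp add: fint_def)
  then show "mcoeff f A = mcoeff 0 A" by (simp add: assms zero_mps.rep_eq)
qed

section \<open>Leibniz rules for the derivatives with respect to single modes\<close>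

lemma lookup_lderiv:
  "Poly_Mapping.lookup (lderiv i p) \<gamma> =
     of_int (Poly_Mapping.lookup \<gamma> i + 1) * Poly_Mapping.lookup p (\<gamma> + Poly_Mapping.single i 1)"
proof -
  have "Poly_Mapping.lookup (lderiv i p) \<gamma> = (\<Sum>\<beta>\<in>Poly_Mapping.keys p.
     if \<beta> = \<gamma> + Poly_Mapping.single i 1 then
       of_int (Poly_Mapping.lookup \<beta> i) * Poly_Mapping.lookup p \<beta> else 0)"
    unfolding lderiv_def lookup_sum
    by (intro sum.cong) (auto simp: lookup_single when_def)
  then show ?thesis by (auto simp: in_keys_iff lookup_add)
qed

lemma lderiv_add: "lderiv i (p + r) = lderiv i p + lderiv i r"
  by (rule poly_mapping_eqI) (simp add: lookup_lderiv lookup_add algebra_simps)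

lemma lderiv_sum: "lderiv i (sum f S) = (\<Sum>x\<in>S. lderiv i (f x))"
  by (induction S rule: infinite_finite_induct) (auto simp: lderiv_add)

lemma lderiv_single:
  "lderiv i (Poly_Mapping.single \<beta> c) =
     Poly_Mapping.single (\<beta> - Poly_Mapping.single i 1) (of_int (Poly_Mapping.lookup \<beta> i) * c)"
  by (simp add: lderiv_def)

text \<open>Two nested inductions over the supports reduce the rule to monomials, where exponents
  add.\<close>

lemma lderiv_mult: "lderiv i (p * r) = lderiv i p * r + p * lderiv i r"
proof (induction p rule: update_induct)
  case (update p \<beta> c)
  have *: "Poly_Mapping.update \<beta> c p = Poly_Mapping.single \<beta> c + p"
    using update(1) by (intro poly_mapping_eqI)
      (auto simp: lookup_update lookup_add lookup_single when_def in_keys_iff)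
  have "lderiv i (Poly_Mapping.single \<beta> c * r) =
      lderiv i (Poly_Mapping.single \<beta> c) * r + Poly_Mapping.single \<beta> c * lderiv i r"
  proof (induction r rule: update_induct)
    case (update r \<gamma> d)
    have r: "Poly_Mapping.update \<gamma> d r = Poly_Mapping.single \<gamma> d + r"
      using update(1) by (intro poly_mapping_eqI)
        (auto simp: lookup_update lookup_add lookup_single when_def in_keys_iff)
    have "\<beta> - Poly_Mapping.single i 1 + \<gamma> = \<beta> + \<gamma> - Poly_Mapping.single i 1"
      "\<beta> + (\<gamma> - Poly_Mapping.single i 1) = \<beta> + \<gamma> - Poly_Mapping.single i 1"
      by (simp_all add: algebra_simps)
    then have "lderiv i (Poly_Mapping.single \<beta> c * Poly_Mapping.single \<gamma> d) =
        lderiv i (Poly_Mapping.single \<beta> c) * Poly_Mapping.single \<gamma> d +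
        Poly_Mapping.single \<beta> c * lderiv i (Poly_Mapping.single \<gamma> d)"
      by (simp add: lderiv_single mult_single lookup_add single_add[symmetric] algebra_simps)
    with update show ?case unfolding r lderiv_add distrib_left distrib_right
      by (simp only: add_ac)
  qed simp
  with update show ?case unfolding * lderiv_add distrib_left distrib_right
    by (simp only: add_ac)
qed simp

lemma pderiv_mode_add: "pderiv_mode i m (f + g) = pderiv_mode i m f + pderiv_mode i m g"
  by (rule mps_eqI) (simp add: pderiv_mode_def plus_mps.rep_eq lderiv_add algebra_simps)

text \<open>
  In the Leibniz rule for a nonzero mode the multiplicity of the variable in a product of two
  monomials splits into the multiplicities in the two factors.
\<close>

lemma weighted_convolution:
  fixes f g :: "('v, 'a::comm_ring_1) mps"
  shows "(\<Sum>A\<in>{A. A \<subseteq># add_mset v M}. of_nat (count A v) * (mcoeff f A * mcoeff g (add_mset v M - A))) =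
     (\<Sum>A\<in>{A. A \<subseteq># M}. of_nat (Suc (count A v)) * mcoeff f (add_mset v A) * mcoeff g (M - A))"
proof -
  let ?t = "\<lambda>A. of_nat (count A v) * (mcoeff f A * mcoeff g (add_mset v M - A))"
  have "(\<Sum>A\<in>{A. A \<subseteq># add_mset v M}. ?t A) = (\<Sum>A\<in>add_mset v ` {A. A \<subseteq># M}. ?t A)"
  proof (rule sum.mono_neutral_right)
    show "\<forall>A\<in>{A. A \<subseteq># add_mset v M} - add_mset v ` {A. A \<subseteq># M}. ?t A = 0"
    proof
      fix A assume A: "A \<in> {A. A \<subseteq># add_mset v M} - add_mset v ` {A. A \<subseteq># M}"
      have "v \<notin># A"
      proof
        assume "v \<in># A"
        then obtain B where "A = add_mset v B" by (meson multi_member_split)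
        with A show False by auto
      qed
      then show "?t A = 0" by (simp add: not_in_iff)
    qed
  qed auto
  also have "\<dots> = (\<Sum>A\<in>{A. A \<subseteq># M}. ?t (add_mset v A))"
    by (subst sum.reindex) (auto simp: inj_on_def)
  finally show ?thesis by (simp add: mult.assoc)
qed

lemma pderiv_mode_mult: "pderiv_mode i m (f * g) = pderiv_mode i m f * g + f * pderiv_mode i m g"
proof (cases "m = 0")
  case True
  then show ?thesis
    by (intro mps_eqI) (simp add: pderiv_mode_def plus_mps.rep_eq times_mps.rep_eq lderiv_sum
        lderiv_mult sum.distrib)
next
  case False
  show ?thesis
  proof (rule mps_eqI)
    fix M
    let ?v = "(i, m)" and ?S = "{A. A \<subseteq># add_mset (i, m) M}"
    have "mcoeff (pderiv_mode i m (f * g)) M =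
        (\<Sum>A\<in>?S. of_nat (Suc (count M ?v)) * (mcoeff f A * mcoeff g (add_mset ?v M - A)))"
      using False by (simp add: pderiv_mode_def times_mps.rep_eq sum_distrib_left)
    also have "\<dots> = (\<Sum>A\<in>?S. of_nat (count A ?v) * (mcoeff f A * mcoeff g (add_mset ?v M - A)) +
        of_nat (count (add_mset ?v M - A) ?v) * (mcoeff f A * mcoeff g (add_mset ?v M - A)))"
    proof (rule sum.cong)
      fix A assume "A \<in> ?S"
      then have "count A ?v \<le> Suc (count M ?v)"
        using mset_subset_eq_count[of A "add_mset ?v M" ?v] by simp
      then have "Suc (count M ?v) = count A ?v + count (add_mset ?v M - A) ?v" by simp
      then show "of_nat (Suc (count M ?v)) * (mcoeff f A * mcoeff g (add_mset ?v M - A)) =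
          of_nat (count A ?v) * (mcoeff f A * mcoeff g (add_mset ?v M - A)) +
          of_nat (count (add_mset ?v M - A) ?v) * (mcoeff f A * mcoeff g (add_mset ?v M - A))"
        by (simp only: of_nat_add distrib_right)
    qed simp
    \<comment> \<open>Passing to complements gives the second sum the shape of the first with
      \<open>f\<close> and \<open>g\<close> exchanged, so \<open>weighted_convolution\<close>
      handles both.\<close>
    also have "\<dots> = (\<Sum>A\<in>?S. of_nat (count A ?v) * (mcoeff f A * mcoeff g (add_mset ?v M - A))) +
        (\<Sum>A\<in>?S. of_nat (count A ?v) * (mcoeff g A * mcoeff f (add_mset ?v M - A)))"
      unfolding sum.distrib
      by (rule arg_cong2[of _ _ _ _ "(+)"], rule refl)
        (rule sum.reindex_bij_witness[where i = "\<lambda>A. add_mset ?v M - A" and j = "\<lambda>A. add_mset ?v M - A"],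
          auto simp: diff_diff_submset mult.commute)
    also have "\<dots> = mcoeff (pderiv_mode i m f * g + pderiv_mode i m g * f) M"
      unfolding weighted_convolution using False
      by (simp add: plus_mps.rep_eq times_mps.rep_eq pderiv_mode_def)
    finally show "mcoeff (pderiv_mode i m (f * g)) M = mcoeff (pderiv_mode i m f * g + f * pderiv_mode i m g) M"
      by (simp add: mult.commute)
  qed
qed

section \<open>Evolutionary derivations and their Leibniz rule\<close>

definition zpart :: "int \<Rightarrow> fser \<Rightarrow> fser" where
  "zpart m f = Mps (\<lambda>M. if zexp M = m then mcoeff f M else 0)"

text \<open>Grouping the terms by the exponent of \<open>B\<close> turns \<open>evol\<close> into a
  finite sum of ordinary products, to which the Leibniz rule of each \<open>pderiv_mode\<close>
  applies. \<open>S\<close> stays free so that one choice serves all submonomials of a given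
  monomial.\<close>

lemma mcoeff_evol:
  assumes "finite S" "zexp ` {B. B \<subseteq># M} \<subseteq> S"
  shows "mcoeff (evol N g f) M = (\<Sum>j=1..N. \<Sum>m\<in>S. mcoeff (pderiv_mode j (- m) f * zpart m (g j)) M)"
proof -
  have "(\<Sum>m\<in>S. mcoeff (pderiv_mode j (- m) f * zpart m (g j)) M) =
      (\<Sum>B\<in>{B. B \<subseteq># M}. mcoeff (pderiv_mode j (- zexp B) f) (M - B) * mcoeff (g j) B)" for j
  proof -
    have "(\<Sum>m\<in>S. mcoeff (pderiv_mode j (- m) f * zpart m (g j)) M) =
      (\<Sum>B\<in>{B. B \<subseteq># M}. \<Sum>m\<in>S. mcoeff (pderiv_mode j (- m) f) (M - B) * mcoeff (zpart m (g j)) B)"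
      unfolding mcoeff_times_swap by (rule sum.swap)
    also have "\<dots> = (\<Sum>B\<in>{B. B \<subseteq># M}. \<Sum>m\<in>S. if m = zexp B then
         mcoeff (pderiv_mode j (- zexp B) f) (M - B) * mcoeff (g j) B else 0)"
      by (intro sum.cong) (auto simp: zpart_def)
    also have "\<dots> = (\<Sum>B\<in>{B. B \<subseteq># M}. mcoeff (pderiv_mode j (- zexp B) f) (M - B) * mcoeff (g j) B)"
      using assms by (intro sum.cong) (auto simp: sum.delta)
    finally show ?thesis .
  qed
  then show ?thesis by (simp add: evol_def)
qed

lemma evol_add: "evol N g (f + h) = evol N g f + evol N g h"
  by (rule mps_eqI) (simp add: evol_def pderiv_mode_add plus_mps.rep_eq algebra_simps sum.distrib)

lemma evol_zero: "evol N g 0 = 0"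
  using evol_add[of N g 0 0] by simp

lemma evol_uminus: "evol N g (- f) = - evol N g f"
  using evol_add[of N g f "- f"] by (simp add: evol_zero eq_neg_iff_add_eq_0 add.commute)

lemma evol_sum: "evol N g (sum f S) = (\<Sum>x\<in>S. evol N g (f x))"
  by (induction S rule: infinite_finite_induct) (auto simp: evol_add evol_zero)

lemma evol_mult: "evol N g (f * h) = evol N g f * h + f * evol N g h"
proof (rule mps_eqI)
  fix M
  define S where "S = zexp ` {B. B \<subseteq># M}"
  have S: "finite S" "zexp ` {B. B \<subseteq># A} \<subseteq> S" if "A \<subseteq># M" for A
    using that by (auto simp: S_def intro: subset_mset.order_trans)
  have L: "mcoeff (evol N g f' * h') M =
      (\<Sum>j=1..N. \<Sum>m\<in>S. mcoeff (pderiv_mode j (- m) f' * zpart m (g j) * h') M)" for f' h'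
  proof -
    have "mcoeff (evol N g f' * h') M = (\<Sum>A\<in>{A. A \<subseteq># M}.
        (\<Sum>j=1..N. \<Sum>m\<in>S. mcoeff (pderiv_mode j (- m) f' * zpart m (g j)) A) * mcoeff h' (M - A))"
      unfolding times_mps.rep_eq[of "evol N g f'"]
      by (intro sum.cong refl arg_cong2[of _ _ _ _ "(*)"] mcoeff_evol S) auto
    also have "\<dots> = (\<Sum>A\<in>{A. A \<subseteq># M}. \<Sum>j=1..N. \<Sum>m\<in>S.
        mcoeff (pderiv_mode j (- m) f' * zpart m (g j)) A * mcoeff h' (M - A))"
      by (simp add: sum_distrib_right)
    also have "\<dots> = (\<Sum>j=1..N. \<Sum>m\<in>S. \<Sum>A\<in>{A. A \<subseteq># M}.
        mcoeff (pderiv_mode j (- m) f' * zpart m (g j)) A * mcoeff h' (M - A))"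
      by (subst sum.swap, rule sum.cong, rule refl, rule sum.swap)
    finally show ?thesis by (simp add: times_mps.rep_eq[of _ h'])
  qed
  have "mcoeff (evol N g (f * h)) M =
      (\<Sum>j=1..N. \<Sum>m\<in>S. mcoeff (pderiv_mode j (- m) (f * h) * zpart m (g j)) M)"
    using S by (intro mcoeff_evol) auto
  also have "\<dots> = (\<Sum>j=1..N. \<Sum>m\<in>S. mcoeff (pderiv_mode j (- m) f * zpart m (g j) * h) M +
      mcoeff (pderiv_mode j (- m) h * zpart m (g j) * f) M)"
    by (simp only: pderiv_mode_mult plus_mps.rep_eq distrib_left distrib_right mult_ac add_ac)
  also have "\<dots> = mcoeff (evol N g f * h + evol N g h * f) M"
    by (simp add: plus_mps.rep_eq L sum.distrib)
  finally show "mcoeff (evol N g (f * h)) M = mcoeff (evol N g f * h + f * evol N g h) M"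
    by (simp add: mult.commute)
qed

lemma evol_one: "evol N g 1 = 0"
  using evol_mult[of N g 1 1] by simp

lemma evol_Lam_general: "evol N g (Lam j) = (if 1 \<le> j \<and> j \<le> N then g j else 0)"
proof (cases "1 \<le> j \<and> j \<le> N")
  case False
  then have "mcoeff (evol N g (Lam j)) M = 0" for M
    by (auto simp: evol_def pderiv_mode_Lam zero_mps.rep_eq intro!: sum.neutral)
  with False show ?thesis by (auto intro!: mps_eqI simp: zero_mps.rep_eq)
qed (simp add: evol_Lam)

lemma evol_fconst: "evol N g (fconst c * f) = fconst c * evol N g f"
proof -
  have "pderiv_mode j m (fconst c) = 0" for j m
    by (rule mps_eqI) (simp add: pderiv_mode_def fconst_def zero_mps.rep_eq lconst_def lderiv_single)
  then have "evol N g (fconst c) = 0"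
    by (intro mps_eqI) (simp add: evol_def zero_mps.rep_eq)
  then show ?thesis by (simp add: evol_mult)
qed

text \<open>Differentiating in mode \<open>- zexp B\<close> uses the coefficient of \<open>f\<close>
  at a monomial of exponent \<open>zexp (M - B) + zexp B = zexp M\<close>, so every term carries the
  same power of \<open>q\<close>.\<close>

lemma evol_shift: "evol N g (shift q k f) = shift q k (evol N g f)"
proof (rule mps_eqI)
  fix M
  have "mcoeff (pderiv_mode j (- zexp B) (shift q k f)) (M - B) =
      lconst (q powi (k * zexp M)) * mcoeff (pderiv_mode j (- zexp B) f) (M - B)" if "B \<subseteq># M" for j B
    using zexp_diff[OF that]
    by (auto simp: pderiv_mode_def mcoeff_shift lderiv_mult lconst_def lderiv_single mult_ac)
  then show "mcoeff (evol N g (shift q k f)) M = mcoeff (shift q k (evol N g f)) M"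
    by (simp add: evol_def mcoeff_shift sum_distrib_left mult.assoc)
qed

text \<open>Here and in \<open>evol_prod\<close>, \<open>w\<close> is a logarithmic derivative; on
  products of powers of the \<open>Lam j\<close> and their inverses these weights add up.\<close>

lemma evol_power:
  assumes "evol N g f = w * f"
  shows "evol N g (f ^ n) = of_nat n * w * f ^ n"
proof (induction n)
  case (Suc n)
  have "evol N g (f ^ Suc n) = w * f * f ^ n + f * (of_nat n * w * f ^ n)"
    by (simp only: power_Suc evol_mult assms Suc)
  then show ?case
    by (simp only: power_Suc of_nat_Suc distrib_left distrib_right mult_1_left mult_1_right mult_ac)
qed (simp add: evol_one)

lemma evol_prod:
  assumes "\<And>x. x \<in> S \<Longrightarrow> evol N g (f x) = w x * f x"
  shows "evol N g (prod f S) = sum w S * prod f S"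
  using assms
proof (induction S rule: infinite_finite_induct)
  case (insert x S)
  then have "evol N g (f x * prod f S) = w x * f x * prod f S + f x * (sum w S * prod f S)"
    by (simp only: evol_mult insert_iff simp_thms)
  then show ?case
    by (simp only: prod.insert[OF insert(1,2)] sum.insert[OF insert(1,2)] distrib_left distrib_right mult_ac)
qed (simp_all add: evol_one)

lemma minv_Lam_cancel: "minv (Lam j) * (Lam j * f) = f"
  by (simp only: mult.assoc[symmetric] mult.commute[of _ "Lam j"] minv_Lam mult_1_left)

lemma evol_minv_Lam: "evol N g (minv (Lam j)) = - (evol N g (Lam j) * minv (Lam j)) * minv (Lam j)"
proof -
  have "evol N g (Lam j) * minv (Lam j) + Lam j * evol N g (minv (Lam j)) = 0"
    using arg_cong[OF minv_Lam, of "evol N g" j] by (simp add: evol_mult evol_one)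
  then have "minv (Lam j) * (evol N g (Lam j) * minv (Lam j) + Lam j * evol N g (minv (Lam j))) = 0"
    by simp
  moreover have "minv (Lam j) * (Lam j * evol N g (minv (Lam j))) = evol N g (minv (Lam j))"
    by (rule minv_Lam_cancel)
  ultimately show ?thesis
    by (simp add: distrib_left eq_neg_iff_add_eq_0 mult_ac add.commute)
qed

section \<open>Evolution of densities\<close>

lemma Lam_Lamrate: "minv (Lam j) * Lamrate q N F j = shift q 1 (Qrate q N F j) - Qrate q N F j"
  unfolding Lamrate_def by (rule minv_Lam_cancel)

text \<open>\<open>Lamrate\<close> is built from \<open>D Q_j = \<Lambda>_j Q_j\<close>, so the
  logarithmic derivative of \<open>Lam j\<close> is \<open>D - 1\<close> applied to
  \<open>Qrate q N F j\<close>.\<close>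

lemma evol_Lampow:
  "evol N (Lamrate q N F) (Lampow \<alpha>) =
     (\<Sum>j=1..N. of_int (Poly_Mapping.lookup \<alpha> j) *
        (shift q 1 (Qrate q N F j) - Qrate q N F j)) * Lampow \<alpha>"
proof -
  let ?g = "Lamrate q N F"
  \<comment> \<open>The keys of \<open>\<alpha>\<close> may lie outside \<open>{1..N}\<close>, where
    \<open>evol N\<close> leaves \<open>Lam j\<close> fixed; hence the value 0 there.\<close>
  define w where "w = (\<lambda>j. if 1 \<le> j \<and> j \<le> N then shift q 1 (Qrate q N F j) - Qrate q N F j else 0)"
  have Lam: "evol N ?g (Lam j) = w j * Lam j" for j
    by (simp add: evol_Lam_general w_def Lamrate_def mult.commute)
  have "evol N ?g (minv (Lam j)) = - w j * minv (Lam j)" for j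
  proof -
    have "evol N ?g (Lam j) * minv (Lam j) = w j"
      by (simp add: Lam mult.assoc minv_Lam)
    then show ?thesis by (simp add: evol_minv_Lam)
  qed
  note pow = evol_power[OF Lam] evol_power[OF this]
  have "evol N ?g (Lampow \<alpha>) =
      (\<Sum>j\<in>Poly_Mapping.keys \<alpha>. of_int (Poly_Mapping.lookup \<alpha> j) * w j) * Lampow \<alpha>"
    unfolding Lampow_def
  proof (rule evol_prod, goal_cases)
    case (1 j)
    then show ?case
    proof (cases "0 \<le> Poly_Mapping.lookup \<alpha> j")
      case True
      then have "of_nat (nat (Poly_Mapping.lookup \<alpha> j)) = (of_int (Poly_Mapping.lookup \<alpha> j) :: fser)"
        by simp
      with True show ?thesis by (simp add: pow)
    next
      case False
      then have "of_nat (nat (- Poly_Mapping.lookup \<alpha> j)) = (- of_int (Poly_Mapping.lookup \<alpha> j) :: fser)"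
        by (simp flip: of_int_minus)
      with False show ?thesis by (simp add: pow)
    qed
  qed
  also have "(\<Sum>j\<in>Poly_Mapping.keys \<alpha>. of_int (Poly_Mapping.lookup \<alpha> j) * w j) =
      (\<Sum>j\<in>{1..N} \<inter> Poly_Mapping.keys \<alpha>. of_int (Poly_Mapping.lookup \<alpha> j) * w j)"
    by (rule sum.mono_neutral_right) (auto simp: w_def)
  also have "\<dots> = (\<Sum>j=1..N. of_int (Poly_Mapping.lookup \<alpha> j) * w j)"
    by (rule sum.mono_neutral_left) (auto simp: in_keys_iff)
  also have "\<dots> = (\<Sum>j=1..N. of_int (Poly_Mapping.lookup \<alpha> j) *
        (shift q 1 (Qrate q N F j) - Qrate q N F j))"
    by (intro sum.cong) (auto simp: w_def)
  finally show ?thesis .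
qed

lemma lookup_hamder:
  "Poly_Mapping.lookup (hamder q N F X) \<alpha> = evol N (Lamrate q N F) (Poly_Mapping.lookup X \<alpha>) +
     (\<Sum>j=1..N. of_int (Poly_Mapping.lookup \<alpha> j) * Qrate q N F j) * Poly_Mapping.lookup X \<alpha>"
  by (simp add: hamder_def lookup_mapp in_keys_iff when_def evol_zero)

lemma hamder_add: "hamder q N F (X + Y) = hamder q N F X + hamder q N F Y"
  by (rule poly_mapping_eqI) (simp add: lookup_hamder lookup_add evol_add algebra_simps)

lemma hamder_diff: "hamder q N F (X - Y) = hamder q N F X - hamder q N F Y"
  using hamder_add[of q N F "X - Y" Y] by simp

lemma hamder_sum: "hamder q N F (sum f S) = (\<Sum>x\<in>S. hamder q N F (f x))"
proof -
  have "hamder q N F 0 = 0" using hamder_diff[of q N F 0 0] by simp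
  then show ?thesis by (induction S rule: infinite_finite_induct) (auto simp: hamder_add)
qed

lemma qshift_sum: "qshift q (sum f S) = (\<Sum>x\<in>S. qshift q (f x))"
proof -
  have "qshift q 0 = 0" using qshift_diff[of q 0 0] by simp
  then show ?thesis by (induction S rule: infinite_finite_induct) (auto simp: qshift_add)
qed

lemma shift_of_int_mult: "shift q k (of_int a * f) = of_int a * shift q k f"
  by (induction a rule: int_induct[where k = 0])
    (simp_all add: shift_0 shift_add shift_diff distrib_right left_diff_distrib)

text \<open>The contribution \<open>(D - 1) Qrate\<close> of \<open>Lampow \<alpha>\<close> and the
  contribution \<open>Qrate\<close> of the \<open>Q_j\<close> add up to \<open>D Qrate\<close>. This
  is what lets the bracket pass to classes modulo total differences.\<close>

lemma hamder_qshift: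
  assumes "q \<noteq> 0"
  shows "hamder q N F (qshift q X) = qshift q (hamder q N F X)"
proof (rule poly_mapping_eqI)
  fix \<alpha>
  let ?x = "Poly_Mapping.lookup X \<alpha>" and ?a = "\<lambda>j. of_int (Poly_Mapping.lookup \<alpha> j) :: fser"
  have "(\<Sum>j=1..N. ?a j * (shift q 1 (Qrate q N F j) - Qrate q N F j)) + (\<Sum>j=1..N. ?a j * Qrate q N F j) =
      shift q 1 (\<Sum>j=1..N. ?a j * Qrate q N F j)"
    by (simp add: shift_sum shift_of_int_mult right_diff_distrib sum_subtractf)
  note * = arg_cong[OF this, of "\<lambda>y. y * (shift q 1 ?x * Lampow \<alpha>)"]
  show "Poly_Mapping.lookup (hamder q N F (qshift q X)) \<alpha> = Poly_Mapping.lookup (qshift q (hamder q N F X)) \<alpha>"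
    using * by (simp add: lookup_hamder lookup_qshift evol_mult evol_shift evol_Lampow shift_add
        shift_mult[OF assms] distrib_left distrib_right mult_ac)
qed

text \<open>The first variation formula. In a monomial \<open>M\<close> of exponent 0 the part
  \<open>M - B\<close> has the exponent opposite to that of \<open>B\<close>, which is the mode that
  \<open>vder\<close> selects.\<close>

lemma fint_evol: "fint (evol N g f) = fint (\<Sum>j=1..N. vder j (fint f) * g j)"
proof (rule mps_eqI)
  fix M
  show "mcoeff (fint (evol N g f)) M = mcoeff (fint (\<Sum>j=1..N. vder j (fint f) * g j)) M"
  proof (cases "zexp M = 0")
    case True
    have "mcoeff (vder j (fint f)) (M - B) = mcoeff (pderiv_mode j (- zexp B) f) (M - B)"
      if "B \<subseteq># M" for B j
      using zexp_diff[OF that] True by (simp add: vder_def pderiv_mode_def fint_def)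
    with True show ?thesis
      by (simp add: fint_def evol_def mcoeff_sum mcoeff_times_swap)
  qed (simp add: fint_def)
qed

section \<open>Pseudo-difference operators\<close>

text \<open>Bounded order makes every sum in \<open>dmult\<close> finite; an infinite one would take
  the default value 0. Coefficients are arbitrary Fourier series, and membership in \<open>J\<close>
  is tracked separately.\<close>

typedef pdo = "{A :: dop. \<exists>m. \<forall>n>m. A n = 0}" morphisms pcoeff Pdo
  by (rule exI[of _ "\<lambda>_. 0"]) simp

setup_lifting type_definition_pdo

lemma pdo_eqI: "(\<And>n. pcoeff A n = pcoeff B n) \<Longrightarrow> A = B"
  by (simp add: pcoeff_inject[symmetric] fun_eq_iff)

definition ord_le :: "int \<Rightarrow> pdo \<Rightarrow> bool" where
  "ord_le m A \<longleftrightarrow> (\<forall>n>m. pcoeff A n = 0)"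

lemma ord_leD: "ord_le m A \<Longrightarrow> m < n \<Longrightarrow> pcoeff A n = 0"
  by (simp add: ord_le_def)

lemma ord_le_exists: "\<exists>m. ord_le m A"
  using pcoeff[of A] by (simp add: ord_le_def)

instantiation pdo :: ab_group_add
begin

lift_definition zero_pdo :: pdo is "\<lambda>n. 0" by simp
lift_definition plus_pdo :: "pdo \<Rightarrow> pdo \<Rightarrow> pdo" is "\<lambda>A B n. A n + B n"
proof goal_cases
  case (1 A B)
  then obtain a b where "\<forall>n>a. A n = 0" "\<forall>n>b. B n = 0" by auto
  then show ?case by (intro exI[of _ "max a b"]) simp
qed
lift_definition minus_pdo :: "pdo \<Rightarrow> pdo \<Rightarrow> pdo" is "\<lambda>A B n. A n - B n"
proof goal_cases
  case (1 A B)
  then obtain a b where "\<forall>n>a. A n = 0" "\<forall>n>b. B n = 0" by auto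
  then show ?case by (intro exI[of _ "max a b"]) simp
qed
lift_definition uminus_pdo :: "pdo \<Rightarrow> pdo" is "\<lambda>A n. - A n" by simp

instance
  by standard (rule pdo_eqI; simp add: plus_pdo.rep_eq minus_pdo.rep_eq uminus_pdo.rep_eq zero_pdo.rep_eq)+

end

lemmas pcoeff_simps = plus_pdo.rep_eq minus_pdo.rep_eq uminus_pdo.rep_eq zero_pdo.rep_eq

text \<open>Concludes the descending arguments on the order, for both uniqueness and existence of
  roots.\<close>

lemma ord_le_all_imp_0: "(\<And>m. ord_le (c - int m) A) \<Longrightarrow> A = 0"
proof (rule pdo_eqI)
  fix n assume A: "\<And>m. ord_le (c - int m) A"
  have "c - int (nat (c - n + 1)) < n" by linarith
  from ord_leD[OF A this] show "pcoeff A n = pcoeff 0 n" by (simp add: pcoeff_simps)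
qed

lemma ord_le_step: "ord_le m A \<Longrightarrow> pcoeff A m = 0 \<Longrightarrow> ord_le (m - 1) A"
  unfolding ord_le_def
proof (intro allI impI)
  fix n assume *: "\<forall>n>m. pcoeff A n = 0" "pcoeff A m = 0" "m - 1 < n"
  then consider "n = m" | "m < n" by linarith
  then show "pcoeff A n = 0" using * by cases auto
qed

lift_definition pone :: pdo is opone
  by (rule exI[of _ 0]) (simp add: opone_def)

definition psingle :: "int \<Rightarrow> fser \<Rightarrow> pdo" where
  "psingle k f = Pdo (\<lambda>n. if n = k then f else 0)"

lemma pcoeff_psingle: "pcoeff (psingle k f) n = (if n = k then f else 0)"
  unfolding psingle_def by (subst Pdo_inverse) (auto intro: exI[of _ k])

lemma dmult_eq_0:
  assumes "\<And>n. n > a \<Longrightarrow> A n = 0" "\<And>n. n > b \<Longrightarrow> B n = 0" "n > a + b"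
  shows "dmult q A B n = 0"
proof -
  have "{k. A k \<noteq> 0 \<and> B (n - k) \<noteq> 0} = {}"
  proof -
    have False if "A k \<noteq> 0" "B (n - k) \<noteq> 0" for k
    proof -
      have "k \<le> a" "n - k \<le> b" using assms that by (meson not_le)+
      with assms(3) show False by simp
    qed
    then show ?thesis by auto
  qed
  then show ?thesis unfolding dmult_def by (simp only: sum.empty)
qed

lift_definition pmul :: "complex \<Rightarrow> pdo \<Rightarrow> pdo \<Rightarrow> pdo" is dmult
proof goal_cases
  case (1 q A B)
  then obtain a b where "\<forall>n>a. A n = 0" "\<forall>n>b. B n = 0" by auto
  then show ?case by (intro exI[of _ "a + b"] allI impI dmult_eq_0) auto
qed

lemma pcoeff_pmul:
  assumes "finite S" "\<And>k. pcoeff A k \<noteq> 0 \<Longrightarrow> pcoeff B (n - k) \<noteq> 0 \<Longrightarrow> k \<in> S"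
  shows "pcoeff (pmul q A B) n = (\<Sum>k\<in>S. pcoeff A k * shift q k (pcoeff B (n - k)))"
  unfolding pmul.rep_eq dmult_def
  using assms by (intro sum.mono_neutral_left) (auto simp: shift_0)

text \<open>The index set in \<open>dmult\<close> depends on which coefficients vanish; a fixed
  interval allows such sums to be added and interchanged.\<close>

lemma pcoeff_pmul_interval:
  assumes "ord_le a A" "ord_le b B" "l \<le> n - b" "a \<le> h"
  shows "pcoeff (pmul q A B) n = (\<Sum>k\<in>{l..h}. pcoeff A k * shift q k (pcoeff B (n - k)))"
proof (rule pcoeff_pmul)
  fix k assume "pcoeff A k \<noteq> 0" "pcoeff B (n - k) \<noteq> 0"
  then have "k \<le> a" "n - k \<le> b" using assms by (meson ord_leD not_le)+
  then show "k \<in> {l..h}" using assms by simp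
qed simp

lemma pcoeff_psingle_pmul: "pcoeff (pmul q (psingle k f) A) n = f * shift q k (pcoeff A (n - k))"
  by (subst pcoeff_pmul[of "{k}"]) (auto simp: pcoeff_psingle split: if_splits)

lemma pcoeff_pmul_psingle: "pcoeff (pmul q A (psingle k f)) n = pcoeff A (n - k) * shift q (n - k) f"
  by (subst pcoeff_pmul[of "{n - k}"]) (auto simp: pcoeff_psingle split: if_splits)

lemma ord_le_pmul: "ord_le a A \<Longrightarrow> ord_le b B \<Longrightarrow> ord_le (a + b) (pmul q A B)"
  unfolding ord_le_def pmul.rep_eq by (auto intro: dmult_eq_0)

lemma pcoeff_pmul_leading:
  assumes "ord_le a A" "ord_le b B"
  shows "pcoeff (pmul q A B) (a + b) = pcoeff A a * shift q a (pcoeff B b)"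
  using pcoeff_pmul_interval[OF assms, of a "a + b" a] by simp

lemma pcoeff_pmul_shifted:
  assumes "finite S" "\<And>m. pcoeff A (m - k) \<noteq> 0 \<Longrightarrow> pcoeff B (n - m) \<noteq> 0 \<Longrightarrow> m \<in> S"
  shows "pcoeff (pmul q A B) (n - k) = (\<Sum>m\<in>S. pcoeff A (m - k) * shift q (m - k) (pcoeff B (n - m)))"
proof -
  have "pcoeff (pmul q A B) (n - k) =
      (\<Sum>m\<in>(\<lambda>m. m - k) ` S. pcoeff A m * shift q m (pcoeff B (n - k - m)))"
  proof (rule pcoeff_pmul)
    fix m assume "pcoeff A m \<noteq> 0" "pcoeff B (n - k - m) \<noteq> 0"
    with assms(2)[of "m + k"] have "m + k \<in> S" by (simp add: algebra_simps)
    then show "m \<in> (\<lambda>m. m - k) ` S" by (auto intro: image_eqI[of _ _ "m + k"])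
  qed (use assms in simp)
  then show ?thesis by (simp add: sum.reindex inj_on_def)
qed

lemma pmul_assoc:
  assumes "q \<noteq> 0"
  shows "pmul q (pmul q A B) C = pmul q A (pmul q B C)"
proof (rule pdo_eqI)
  fix n
  obtain a b c where o: "ord_le a A" "ord_le b B" "ord_le c C" using ord_le_exists by metis
  \<comment> \<open>\<open>K\<close> bounds the powers of \<open>D\<close> taken from
    \<open>A\<close>, and \<open>M\<close> those taken from the product of \<open>A\<close> and
    \<open>B\<close>. Neither range depends on the other index, so the double sum can be
    interchanged.\<close>
  define K M where "K = {n - b - c..a}" and "M = {n - c..a + b}"
  have AB: "pcoeff (pmul q A B) m = (\<Sum>k\<in>K. pcoeff A k * shift q k (pcoeff B (m - k)))" if "m \<in> M" for m
    unfolding K_def using o that by (intro pcoeff_pmul_interval) (auto simp: M_def)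
  have BC: "pcoeff (pmul q B C) (n - k) =
      (\<Sum>m\<in>M. pcoeff B (m - k) * shift q (m - k) (pcoeff C (n - m)))" if "k \<in> K" for k
  proof (rule pcoeff_pmul_shifted)
    fix m assume "pcoeff B (m - k) \<noteq> 0" "pcoeff C (n - m) \<noteq> 0"
    then have "m - k \<le> b" "n - m \<le> c" using o by (meson ord_leD not_le)+
    with that show "m \<in> M" by (auto simp: K_def M_def)
  qed (simp add: M_def)
  have "pcoeff (pmul q (pmul q A B) C) n =
      (\<Sum>m\<in>M. pcoeff (pmul q A B) m * shift q m (pcoeff C (n - m)))"
    unfolding M_def by (rule pcoeff_pmul_interval[OF ord_le_pmul[OF o(1,2)] o(3)]) auto
  also have "\<dots> = (\<Sum>m\<in>M. \<Sum>k\<in>K. pcoeff A k * shift q k (pcoeff B (m - k)) * shift q m (pcoeff C (n - m)))"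
    by (simp add: AB sum_distrib_right)
  also have "\<dots> = (\<Sum>k\<in>K. \<Sum>m\<in>M. pcoeff A k * shift q k (pcoeff B (m - k)) * shift q m (pcoeff C (n - m)))"
    by (rule sum.swap)
  also have "\<dots> = (\<Sum>k\<in>K. pcoeff A k * shift q k (pcoeff (pmul q B C) (n - k)))"
    by (simp add: BC shift_sum shift_mult[OF assms] shift_shift[OF assms] sum_distrib_left mult.assoc)
  also have "\<dots> = pcoeff (pmul q A (pmul q B C)) n"
    unfolding K_def using o
    by (intro pcoeff_pmul_interval[symmetric, of _ _ "b + c"] ord_le_pmul) auto
  finally show "pcoeff (pmul q (pmul q A B) C) n = pcoeff (pmul q A (pmul q B C)) n" .
qed

lemma pone_eq_psingle: "pone = psingle 0 1"
  by (rule pdo_eqI) (simp add: pone.rep_eq pcoeff_psingle opone_def)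

lemma pmul_add_left: "pmul q (A + B) C = pmul q A C + pmul q B C"
proof (rule pdo_eqI)
  fix n
  obtain a b c where o: "ord_le a A" "ord_le b B" "ord_le c C" using ord_le_exists by metis
  let ?S = "{n - c..max a b}"
  have "ord_le (max a b) (A + B)" "ord_le (max a b) A" "ord_le (max a b) B"
    using o by (auto simp: ord_le_def pcoeff_simps)
  then show "pcoeff (pmul q (A + B) C) n = pcoeff (pmul q A C + pmul q B C) n"
    using o(3) by (simp add: pcoeff_simps pcoeff_pmul_interval[of "max a b" _ c _ "n - c" n "max a b"]
        distrib_right sum.distrib)
qed

lemma pmul_add_right: "pmul q A (B + C) = pmul q A B + pmul q A C"
proof (rule pdo_eqI)
  fix n
  obtain a b c where o: "ord_le a A" "ord_le b B" "ord_le c C" using ord_le_exists by metis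
  have "ord_le (max b c) (B + C)" "ord_le (max b c) B" "ord_le (max b c) C"
    using o by (auto simp: ord_le_def pcoeff_simps)
  then show "pcoeff (pmul q A (B + C)) n = pcoeff (pmul q A B + pmul q A C) n"
    using o(1) by (simp add: pcoeff_simps pcoeff_pmul_interval[of a _ "max b c" _ "n - max b c" n a]
        shift_add distrib_left sum.distrib)
qed

text \<open>The product depends on \<open>q\<close>, so the ring laws feed a locale interpretation
  rather than a type class instance.\<close>

lemma class_ring_1_pdo:
  assumes "q \<noteq> 0"
  shows "class.ring_1 pone (pmul q) (+) 0 (-) uminus"
proof
  fix A B C :: pdo
  show "pmul q (pmul q A B) C = pmul q A (pmul q B C)" by (rule pmul_assoc[OF assms])
  show "pmul q pone A = A"
    by (rule pdo_eqI) (simp add: pone_eq_psingle pcoeff_psingle_pmul shift_zero_int)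
  show "pmul q A pone = A"
    by (rule pdo_eqI) (simp add: pone_eq_psingle pcoeff_pmul_psingle shift_one)
  show "pmul q (A + B) C = pmul q A C + pmul q B C" by (rule pmul_add_left)
  show "pmul q A (B + C) = pmul q A B + pmul q A C" by (rule pmul_add_right)
  show "(0::pdo) \<noteq> pone"
  proof
    assume "0 = pone"
    then have "pcoeff 0 0 = pcoeff pone 0" by simp
    then show False by (simp add: pone.rep_eq opone_def pcoeff_simps)
  qed
qed

section \<open>The trace, and flows acting on operators\<close>

definition tr :: "pdo \<Rightarrow> fser" where
  "tr A = fint (Res (pcoeff A))"

lemma tr_add: "tr (A + B) = tr A + tr B"
  by (simp add: tr_def Res_def pcoeff_simps fint_add)

text \<open>The residues of \<open>A_k D^k B_(-k) D^(-k)\<close> and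
  \<open>B_(-k) D^(-k) A_k D^k\<close> differ by a shift, which \<open>fint\<close> does not
  see.\<close>

lemma tr_commute:
  assumes "q \<noteq> 0"
  shows "tr (pmul q A B) = tr (pmul q B A)"
proof -
  obtain a b where o: "ord_le a A" "ord_le b B" using ord_le_exists by metis
  have "tr (pmul q A B) = (\<Sum>k\<in>{-b..a}. fint (pcoeff A k * shift q k (pcoeff B (- k))))"
    unfolding tr_def Res_def using o
    by (subst pcoeff_pmul_interval[of a _ b _ "-b" _ a]) (auto simp: fint_sum)
  also have "\<dots> = (\<Sum>k\<in>{-b..a}. fint (pcoeff B (- k) * shift q (- k) (pcoeff A k)))"
  proof (rule sum.cong)
    fix k
    have "fint (pcoeff A k * shift q k (pcoeff B (- k))) =
        fint (shift q (- k) (pcoeff A k * shift q k (pcoeff B (- k))))"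
      by (simp add: fint_shift)
    then show "fint (pcoeff A k * shift q k (pcoeff B (- k))) = fint (pcoeff B (- k) * shift q (- k) (pcoeff A k))"
      by (simp add: shift_mult[OF assms] shift_shift[OF assms] shift_zero_int mult.commute)
  qed simp
  also have "\<dots> = (\<Sum>k\<in>{-a..b}. fint (pcoeff B k * shift q k (pcoeff A (- k))))"
    by (rule sum.reindex_bij_witness[where i = uminus and j = uminus]) auto
  also have "\<dots> = tr (pmul q B A)"
    unfolding tr_def Res_def using o
    by (subst pcoeff_pmul_interval[of b _ a _ "-a" _ b]) (auto simp: fint_sum)
  finally show ?thesis .
qed

definition pevol :: "nat \<Rightarrow> (nat \<Rightarrow> fser) \<Rightarrow> pdo \<Rightarrow> pdo" where
  "pevol N g A = Pdo (\<lambda>n. evol N g (pcoeff A n))"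

lemma pcoeff_pevol: "pcoeff (pevol N g A) n = evol N g (pcoeff A n)"
proof -
  obtain a where "ord_le a A" using ord_le_exists by blast
  then show ?thesis unfolding pevol_def
    by (subst Pdo_inverse) (auto simp: ord_le_def evol_zero intro!: exI[of _ a])
qed

lemma pevol_pone: "pevol N g pone = 0"
  by (rule pdo_eqI) (simp add: pcoeff_pevol pone.rep_eq opone_def pcoeff_simps evol_one evol_zero)

text \<open>\<open>D\<close> is constant along the flow: by \<open>evol_shift\<close> the derivation
  passes through the shifts in the product.\<close>

lemma pevol_pmul: "pevol N g (pmul q A B) = pmul q (pevol N g A) B + pmul q A (pevol N g B)"
proof (rule pdo_eqI)
  fix n
  obtain a b where o: "ord_le a A" "ord_le b B" using ord_le_exists by metis
  then have o': "ord_le a (pevol N g A)" "ord_le b (pevol N g B)"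
    by (auto simp: ord_le_def pcoeff_pevol evol_zero)
  note I = pcoeff_pmul_interval[of a _ b _ "n - b" n a]
  show "pcoeff (pevol N g (pmul q A B)) n = pcoeff (pmul q (pevol N g A) B + pmul q A (pevol N g B)) n"
    using o o' by (simp add: pcoeff_pevol pcoeff_simps I evol_sum evol_mult evol_shift sum.distrib)
qed

lemma tr_pevol: "tr (pevol N g A) = fint (evol N g (Res (pcoeff A)))"
  by (simp add: tr_def Res_def pcoeff_pevol)

section \<open>Roots of monic operators\<close>

locale qshift_ring =
  fixes q :: complex
  assumes q_nonzero: "q \<noteq> 0"
begin

sublocale pdo: ring_1 pone "pmul q" "(+)" "0 :: pdo" "(-)" uminus
  by (rule class_ring_1_pdo[OF q_nonzero])

abbreviation pmul_infix (infixl "\<odot>" 70) where "A \<odot> B \<equiv> pmul q A B"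
abbreviation ppow (infixr "^^^" 80) where "A ^^^ n \<equiv> pdo.power A n"

definition monic :: "int \<Rightarrow> pdo \<Rightarrow> bool" where
  "monic n A \<longleftrightarrow> ord_le n A \<and> pcoeff A n = 1"

lemma ord_le_monic_diff: "monic m A \<Longrightarrow> monic m B \<Longrightarrow> ord_le (m - 1) (A - B)"
  by (rule ord_le_step) (auto simp: monic_def ord_le_def pcoeff_simps)

lemma monic_pone: "monic 0 pone"
  by (simp add: monic_def ord_le_def pone.rep_eq opone_def)

lemma monic_pmul: "monic a A \<Longrightarrow> monic b B \<Longrightarrow> monic (a + b) (A \<odot> B)"
  by (simp add: monic_def ord_le_pmul pcoeff_pmul_leading shift_one)

lemma monic_power: "monic 1 A \<Longrightarrow> monic (int n) (A ^^^ n)"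
  by (induction n) (auto simp: monic_pone intro: monic_pmul)

text \<open>Linearizes the \<open>n\<close>-th power at leading order. Each further factor
  \<open>B\<close> has leading term \<open>D\<close> and shifts the earlier contributions once more,
  which produces \<open>1 + D + ... + D^(n-1)\<close>.\<close>

lemma power_perturbation:
  assumes A: "monic 1 A" and B: "monic 1 B" and AB: "ord_le m (A - B)"
  shows "ord_le (int n - 1 + m) (A ^^^ n - B ^^^ n) \<and>
    pcoeff (A ^^^ n - B ^^^ n) (int n - 1 + m) = (\<Sum>k<n. shift q (int k) (pcoeff (A - B) m))"
proof (induction n)
  case 0
  then show ?case by (simp add: ord_le_def pcoeff_simps)
next
  case (Suc n)
  let ?E = "(A - B) \<odot> A ^^^ n" and ?F = "B \<odot> (A ^^^ n - B ^^^ n)"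
  have eq: "A ^^^ Suc n - B ^^^ Suc n = ?E + ?F"
    by (simp add: pdo.left_diff_distrib pdo.right_diff_distrib)
  have An: "ord_le (int n) (A ^^^ n)" "pcoeff (A ^^^ n) (int n) = 1"
    using monic_power[OF A] by (auto simp: monic_def)
  have B': "ord_le 1 B" "pcoeff B 1 = 1" using B by (auto simp: monic_def)
  have E: "ord_le (int n + m) ?E" "pcoeff ?E (int n + m) = pcoeff (A - B) m"
    using ord_le_pmul[OF AB An(1)] pcoeff_pmul_leading[OF AB An(1)] An(2)
    by (simp_all add: shift_one add.commute)
  have F: "ord_le (int n + m) ?F"
    "pcoeff ?F (int n + m) = shift q 1 (\<Sum>k<n. shift q (int k) (pcoeff (A - B) m))"
    using ord_le_pmul[OF B'(1) conjunct1[OF Suc]] pcoeff_pmul_leading[OF B'(1) conjunct1[OF Suc]]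
      B'(2) conjunct2[OF Suc] by simp_all
  have "pcoeff (?E + ?F) (int n + m) = (\<Sum>k<Suc n. shift q (int k) (pcoeff (A - B) m))"
    using E(2) F(2) unfolding sum.lessThan_Suc_shift
    by (simp add: pcoeff_simps shift_sum shift_shift[OF q_nonzero] shift_zero_int add.commute)
  moreover have "ord_le (int n + m) (?E + ?F)"
    using E(1) F(1) by (simp add: ord_le_def pcoeff_simps)
  ultimately show ?case unfolding eq by simp
qed

section \<open>Closure properties of the coefficient ring\<close>

lemma J_0: "0 \<in> J q N"
proof -
  have "fconst 0 = 0" by (rule mps_eqI) (simp add: fconst_def lconst_def zero_mps.rep_eq)
  then show ?thesis using J_const[of 0 q N] by simp
qed

lemma J_1: "1 \<in> J q N"
proof -
  have "fconst 1 = 1" by (rule mps_eqI) (simp add: fconst_def lconst_1 one_mps.rep_eq)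
  then show ?thesis using J_const[of 1 q N] by simp
qed

lemma J_uminus: "f \<in> J q N \<Longrightarrow> - f \<in> J q N"
proof -
  assume "f \<in> J q N"
  moreover have "fconst (- 1) * f = - f"
    by (rule mps_eqI) (simp add: fconst_mult_mcoeff uminus_mps.rep_eq lconst_def single_uminus)
  ultimately show ?thesis using J_mult[OF J_const[of "- 1"]] by metis
qed

lemma J_diff: "f \<in> J q N \<Longrightarrow> g \<in> J q N \<Longrightarrow> f - g \<in> J q N"
  using J_add[OF _ J_uminus] by (metis diff_conv_add_uminus)

lemma J_sum: "(\<And>x. x \<in> S \<Longrightarrow> f x \<in> J q N) \<Longrightarrow> sum f S \<in> J q N"
  by (induction S rule: infinite_finite_induct) (auto intro: J_0 J_add)

lemma J_shift_int: "f \<in> J q N \<Longrightarrow> shift q k f \<in> J q N"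
proof (induction k rule: int_induct[where k = 0])
  case (step1 i)
  then have "shift q 1 (shift q i f) \<in> J q N" by (intro J_shift) auto
  then show ?case by (simp add: shift_shift[OF q_nonzero] add.commute)
next
  case (step2 i)
  then have "shift q 1 (shift q (i - 1) f) \<in> J q N" by (simp add: shift_shift[OF q_nonzero])
  then show ?case by (rule J_unshift)
qed (simp add: shift_zero_int)

lemma J_pmul:
  assumes "\<And>n. pcoeff A n \<in> J q N" "\<And>n. pcoeff B n \<in> J q N"
  shows "pcoeff (A \<odot> B) n \<in> J q N"
  unfolding pmul.rep_eq dmult_def by (intro J_sum J_mult J_shift_int assms)

lemma J_pone: "pcoeff pone n \<in> J q N"
  by (simp add: pone.rep_eq opone_def J_0 J_1)

lemma J_ppow: "(\<And>n. pcoeff A n \<in> J q N) \<Longrightarrow> pcoeff (A ^^^ k) n \<in> J q N"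
  by (induction k arbitrary: n) (simp_all add: J_pone J_pmul)

lemma pcoeff_power: "pcoeff (A ^^^ n) = dpow q (pcoeff A) n"
  by (induction n) (simp_all add: pone.rep_eq pmul.rep_eq)

end

section \<open>Inverting \<open>1 + D + ... + D^(N-1)\<close> and extracting roots\<close>

locale generic_q = qshift_ring +
  fixes N :: nat
  assumes q_generic: "1 \<le> k \<Longrightarrow> q ^ k \<noteq> 1" and N_ge_2: "2 \<le> N"
begin

lemma q_powi_neq_1: "m \<noteq> 0 \<Longrightarrow> q powi m \<noteq> 1"
proof
  assume m: "m \<noteq> 0" and 1: "q powi m = 1"
  from 1 have "q ^ nat \<bar>m\<bar> = 1"
    by (cases "0 \<le> m") (auto simp: power_int_def power_inverse)
  moreover have "1 \<le> nat \<bar>m\<bar>" using m by linarith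
  ultimately show False using q_generic by blast
qed

definition shift_symbol :: "int \<Rightarrow> complex" where
  "shift_symbol m = (\<Sum>k<N. q powi (int k * m))"

text \<open>At \<open>m = 0\<close> the symbol is \<open>N\<close>; otherwise it is a geometric sum
  whose vanishing would force \<open>q powi (m * int N) = 1\<close>.\<close>

lemma shift_symbol_nonzero: "shift_symbol m \<noteq> 0"
proof (cases "m = 0")
  case True
  then show ?thesis using N_ge_2 by (simp add: shift_symbol_def)
next
  case False
  have "shift_symbol m = (\<Sum>k<N. (q powi m) ^ k)"
    by (simp add: shift_symbol_def power_int_power mult.commute power_int_mult)
  then have "(1 - q powi m) * shift_symbol m = 1 - (q powi m) ^ N"
    by (simp add: one_diff_power_eq)
  moreover have "(q powi m) ^ N \<noteq> 1"
    using q_powi_neq_1[of "m * int N"] False N_ge_2 by (simp add: power_int_mult)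
  ultimately show ?thesis by auto
qed

lemma sum_shift_eq_fmul: "(\<Sum>k<N. shift q (int k) f) = fmul shift_symbol f"
  by (rule mps_eqI)
    (simp add: mcoeff_sum mcoeff_shift mcoeff_fmul shift_symbol_def lconst_sum sum_distrib_right)

definition sum_shift_inv :: "fser \<Rightarrow> fser" where
  "sum_shift_inv = fmul (\<lambda>m. 1 / shift_symbol m)"

lemma sum_shift_inv: "(\<Sum>k<N. shift q (int k) (sum_shift_inv f)) = f"
  unfolding sum_shift_eq_fmul sum_shift_inv_def
  by (rule mps_eqI)
    (simp add: mcoeff_fmul mult.assoc[symmetric] lconst_mult shift_symbol_nonzero lconst_1)

lemma sum_shift_eq_0:
  assumes "(\<Sum>k<N. shift q (int k) f) = 0"
  shows "f = 0"
proof -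
  have "f = sum_shift_inv (fmul shift_symbol f)"
    unfolding sum_shift_inv_def
    by (rule mps_eqI)
      (simp add: mcoeff_fmul mult.assoc[symmetric] lconst_mult shift_symbol_nonzero lconst_1)
  also have "\<dots> = sum_shift_inv 0" using assms by (simp add: sum_shift_eq_fmul)
  also have "\<dots> = 0"
    unfolding sum_shift_inv_def by (rule mps_eqI) (simp add: mcoeff_fmul zero_mps.rep_eq)
  finally show ?thesis .
qed

text \<open>By \<open>power_perturbation\<close>, equality of the powers forces
  \<open>1 + D + ... + D^(N-1)\<close> to kill the leading coefficient of \<open>A - B\<close>, so
  the order of the difference drops without end.\<close>

lemma root_unique:
  assumes A: "monic 1 A" and B: "monic 1 B" and eq: "A ^^^ N = B ^^^ N"
  shows "A = B"
proof -
  have "ord_le (0 - int m) (A - B)" for m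
  proof (induction m)
    case 0
    then show ?case using ord_le_monic_diff[OF A B] by simp
  next
    case (Suc m)
    have "(\<Sum>k<N. shift q (int k) (pcoeff (A - B) (0 - int m))) = 0"
      using power_perturbation[OF A B Suc, of N] by (simp add: eq pcoeff_simps)
    then have "pcoeff (A - B) (0 - int m) = 0" by (rule sum_shift_eq_0)
    from ord_le_step[OF Suc this] have "ord_le (0 - int m - 1) (A - B)" .
    moreover have "0 - int m - 1 = 0 - int (Suc m)" by simp
    ultimately show ?case by metis
  qed
  from ord_le_all_imp_0[OF this] show ?thesis by simp
qed

lemma J_sum_shift_inv: "f \<in> J q N \<Longrightarrow> sum_shift_inv f \<in> J q N"
  by (rule J_divide) (simp add: sum_shift_inv)

text \<open>Successive approximation from \<open>D\<close>: stage \<open>m + 1\<close> adds the term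
  in \<open>D^(-m)\<close> that cancels the leading coefficient of the defect. The coefficient of
  \<open>D^n\<close> is final from stage \<open>nat (1 - n)\<close> on.\<close>

primrec root_approx :: "pdo \<Rightarrow> nat \<Rightarrow> pdo" where
  "root_approx L 0 = psingle 1 1"
| "root_approx L (Suc m) = root_approx L m + psingle (- int m)
     (sum_shift_inv (pcoeff (L - root_approx L m ^^^ N) (int N - 1 - int m)))"

lemma root_approx:
  assumes L: "monic (int N) L"
  shows "monic 1 (root_approx L m) \<and> ord_le (int N - 1 - int m) (L - root_approx L m ^^^ N)"
proof (induction m)
  case 0
  have "monic 1 (psingle 1 1)" by (simp add: monic_def ord_le_def pcoeff_psingle)
  then show ?case using ord_le_monic_diff[OF L monic_power] by simp
next
  case (Suc m)
  define A A' where "A = root_approx L m" and "A' = root_approx L (Suc m)"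
  define r where "r = pcoeff (L - A ^^^ N) (int N - 1 - int m)"
  have A': "A' = A + psingle (- int m) (sum_shift_inv r)" by (simp add: A_def A'_def r_def)
  have A: "monic 1 A" and o: "ord_le (int N - 1 - int m) (L - A ^^^ N)" using Suc by (auto simp: A_def)
  have mA': "monic 1 A'" using A by (auto simp: A' monic_def ord_le_def pcoeff_simps pcoeff_psingle)
  have d: "ord_le (- int m) (A' - A)" "pcoeff (A' - A) (- int m) = sum_shift_inv r"
    by (auto simp: A' ord_le_def pcoeff_psingle)
  have p: "ord_le (int N - 1 - int m) (A' ^^^ N - A ^^^ N)"
    "pcoeff (A' ^^^ N - A ^^^ N) (int N - 1 - int m) = r"
    using power_perturbation[OF mA' A d(1), of N] by (simp_all add: d(2) sum_shift_inv)
  have eq: "L - A' ^^^ N = (L - A ^^^ N) - (A' ^^^ N - A ^^^ N)" by simp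
  have "ord_le (int N - 1 - int m - 1) (L - A' ^^^ N)"
    unfolding eq using o p
    by (intro ord_le_step) (auto simp: ord_le_def r_def minus_pdo.rep_eq)
  with mA' show ?case by (simp add: A'_def[symmetric] algebra_simps del: root_approx.simps)
qed

lemma J_root_approx:
  assumes "\<And>n. pcoeff L n \<in> J q N"
  shows "pcoeff (root_approx L m) n \<in> J q N"
proof (induction m arbitrary: n)
  case 0
  then show ?case by (simp add: pcoeff_psingle J_0 J_1)
next
  case (Suc m)
  then show ?case
    by (auto simp: plus_pdo.rep_eq minus_pdo.rep_eq pcoeff_psingle
        intro!: J_add J_0 J_diff J_sum_shift_inv J_ppow assms)
qed

lemma pcoeff_root_approx_stable:
  assumes "nat (1 - n) \<le> m"
  shows "pcoeff (root_approx L m) n = pcoeff (root_approx L (nat (1 - n))) n"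
  using assms
proof (induction m rule: dec_induct)
  case (step m)
  then have "n \<noteq> - int m" by linarith
  with step show ?case by (simp add: plus_pdo.rep_eq pcoeff_psingle)
qed simp

lemma root_exists:
  assumes L: "monic (int N) L" and JL: "\<And>n. pcoeff L n \<in> J q N"
  shows "\<exists>A. monic 1 A \<and> (\<forall>n. pcoeff A n \<in> J q N) \<and> A ^^^ N = L"
proof -
  \<comment> \<open>The coefficientwise limit: each coefficient is read off at a stage where it is
    already final.\<close>
  define A where "A = Pdo (\<lambda>n. pcoeff (root_approx L (nat (1 - n))) n)"
  have A: "pcoeff A n = pcoeff (root_approx L (nat (1 - n))) n" for n
    unfolding A_def by (subst Pdo_inverse) (auto simp: pcoeff_psingle intro!: exI[of _ 1])
  have mA: "monic 1 A"
    by (auto simp: monic_def ord_le_def A pcoeff_psingle)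
  have "ord_le (int N - 1 - int m) (L - A ^^^ N)" for m
  proof -
    let ?R = "root_approx L m"
    have "pcoeff (?R - A) n = 0" if "n > - int m" for n
      using pcoeff_root_approx_stable[of n m L] that by (simp add: minus_pdo.rep_eq A)
    then have "ord_le (- int m) (?R - A)" by (simp add: ord_le_def)
    from power_perturbation[OF conjunct1[OF root_approx[OF L]] mA this, of N]
    have "ord_le (int N - 1 - int m) (?R ^^^ N - A ^^^ N)" by simp
    moreover have "L - A ^^^ N = (L - ?R ^^^ N) + (?R ^^^ N - A ^^^ N)" by simp
    ultimately show ?thesis
      using conjunct2[OF root_approx[OF L, of m]] unfolding ord_le_def by (metis plus_pdo.rep_eq add_0)
  qed
  from ord_le_all_imp_0[OF this] have "A ^^^ N = L" by simp
  with mA show ?thesis using J_root_approx[OF JL] by (auto simp: A)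
qed

end

section \<open>Variational derivatives of the hamiltonians\<close>

lemma wrap_bounds: "1 \<le> N \<Longrightarrow> 1 \<le> wrap N i \<and> wrap N i \<le> N"
  by (simp add: wrap_def Suc_leI)

lemma wrap_id: "1 \<le> i \<Longrightarrow> i \<le> N \<Longrightarrow> wrap N i = i"
  by (cases i) (auto simp: wrap_def)

lemma wrap_period: "1 \<le> N \<Longrightarrow> wrap N (i + N) = wrap N i"
proof -
  assume "1 \<le> N"
  then have "i + N + N - 1 = (i + N - 1) + N" by simp
  then show ?thesis by (simp only: wrap_def mod_add_self2)
qed

lemma wrap_add: "1 \<le> N \<Longrightarrow> wrap N (wrap N i + k) = wrap N (i + k)"
proof -
  assume N: "1 \<le> N"
  then have "wrap N i + k + N - 1 = (i + N - 1) mod N + (k + N)"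
    and eq: "i + N - 1 + (k + N) = i + k + N + N - 1"
    by (simp_all add: wrap_def)
  then have "wrap N (wrap N i + k) = (i + N - 1 + (k + N)) mod N + 1"
    unfolding wrap_def[of N "wrap N i + k"] by (simp only: mod_add_left_eq)
  also have "\<dots> = wrap N (i + k + N)" by (simp only: eq wrap_def)
  finally show ?thesis using N by (simp add: wrap_period)
qed

text \<open>Moving the window by one trades the value at \<open>i\<close> for the value at
  \<open>i + N\<close>, and these agree.\<close>

lemma sum_wrap:
  fixes h :: "nat \<Rightarrow> 'a::ab_group_add"
  assumes "1 \<le> N" "1 \<le> i"
  shows "(\<Sum>l<N. h (wrap N (i + l))) = (\<Sum>j=1..N. h j)"
  using assms(2)
proof (induction i rule: nat_induct_at_least)
  case base
  have "(\<Sum>l<N. h (wrap N (1 + l))) = (\<Sum>l<N. h (Suc l))"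
    by (intro sum.cong) (auto simp: wrap_def)
  then show ?case by (simp add: sum.atLeast1_atMost_eq)
next
  case (Suc i)
  have "(\<Sum>l<N. h (wrap N (Suc i + l))) + h (wrap N i) = (\<Sum>l<Suc N. h (wrap N (i + l)))"
    by (subst sum.lessThan_Suc_shift) (simp add: add.commute)
  also have "\<dots> = (\<Sum>l<N. h (wrap N (i + l))) + h (wrap N i)"
    using assms by (simp add: wrap_period)
  finally show ?case using Suc by simp
qed

lemma fconst_of_nat_cancel:
  assumes "0 < k"
  shows "fconst (1 / of_nat k) * (of_nat k * f) = f"
proof (rule mps_eqI)
  fix M
  have "mcoeff (of_nat k * f) M = lconst (of_nat k) * mcoeff f M" for k
    by (induction k)
      (simp_all add: zero_mps.rep_eq plus_mps.rep_eq distrib_right lconst_def single_add)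
  then have "mcoeff (fconst (1 / of_nat k) * (of_nat k * f)) M =
      lconst (1 / of_nat k) * lconst (of_nat k) * mcoeff f M"
    by (simp only: fconst_mult_mcoeff mult.assoc)
  then show "mcoeff (fconst (1 / of_nat k) * (of_nat k * f)) M = mcoeff f M"
    using assms by (simp only: lconst_mult) (simp add: lconst_1)
qed

lemma of_nat_cancel: "0 < k \<Longrightarrow> of_nat k * f = of_nat k * (g :: fser) \<Longrightarrow> f = g"
  by (metis fconst_of_nat_cancel)

lemma mpow_diagm:
  assumes "i \<in> {1..N}" "j \<in> {1..N}"
  shows "mpow q N (diagm d) n i j = (if i = j then dpow q (d i) n else (\<lambda>_. 0))"
  using assms(1)
proof (induction n arbitrary: i)
  case 0
  then show ?case by (simp add: diagm_def)
next
  case (Suc n)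
  have z: "dmult q (\<lambda>_. 0) B = (\<lambda>_. 0)" "dmult q B (\<lambda>_. 0) = (\<lambda>_. 0)" for B
    by (simp_all add: dmult_def)
  have "mpow q N (diagm d) (Suc n) i j m = dmult q (d i) (mpow q N (diagm d) n i j) m" for m
  proof -
    have "mpow q N (diagm d) (Suc n) i j m =
      (\<Sum>l=1..N. if l = i then dmult q (d i) (mpow q N (diagm d) n i j) m else 0)"
      unfolding mpow.simps mmult_def by (intro sum.cong) (auto simp: diagm_def z)
    then show ?thesis using Suc.prems by simp
  qed
  then show ?case unfolding Suc.IH[OF Suc.prems] by (simp add: fun_eq_iff z)
qed

section \<open>First-order factors, their inverses, and traces of powers\<close>

context qshift_ring
begin

definition factor :: "fser \<Rightarrow> pdo" where
  "factor f = psingle 1 1 - psingle 0 f"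

lemma monic_factor: "monic 1 (factor f)"
  by (simp add: monic_def ord_le_def factor_def minus_pdo.rep_eq pcoeff_psingle)

lemma pcoeff_factor_left: "pcoeff (factor f \<odot> A) n = shift q 1 (pcoeff A (n - 1)) - f * pcoeff A n"
  by (simp add: factor_def pdo.left_diff_distrib minus_pdo.rep_eq pcoeff_psingle_pmul shift_zero_int)

lemma pcoeff_factor_right: "pcoeff (A \<odot> factor f) n = pcoeff A (n - 1) - pcoeff A n * shift q n f"
  by (simp add: factor_def pdo.right_diff_distrib minus_pdo.rep_eq pcoeff_pmul_psingle shift_one)

text \<open>The coefficient of \<open>D^(-k-1)\<close> in the right inverse of
  \<open>factor f\<close>; the recursion compares coefficients in \<open>(D - f) Y = 1\<close>.
  \<open>left_inv_coeff\<close> solves the mirrored equation.\<close>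

primrec right_inv_coeff :: "fser \<Rightarrow> nat \<Rightarrow> fser" where
  "right_inv_coeff f 0 = 1"
| "right_inv_coeff f (Suc k) = shift q (- 1) (f * right_inv_coeff f k)"

primrec left_inv_coeff :: "fser \<Rightarrow> nat \<Rightarrow> fser" where
  "left_inv_coeff f 0 = 1"
| "left_inv_coeff f (Suc k) = left_inv_coeff f k * shift q (- int (Suc k)) f"

lemma int_neg_cases:
  fixes n :: int
  obtains "n > 0" | "n = 0" | k where "n = - int (Suc k)"
proof -
  have "n = - int (Suc (nat (- n - 1)))" if "n < 0" using that by simp
  then show thesis using that by (metis linorder_less_linear)
qed

lemma factor_invertible: "\<exists>Y. factor f \<odot> Y = pone \<and> Y \<odot> factor f = pone \<and> monic (- 1) Y"
proof -
  define neg where "neg c = Pdo (\<lambda>n. if n \<ge> 0 then 0 else c (nat (- n - 1)))" for c :: "nat \<Rightarrow> fser"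
  have neg: "pcoeff (neg c) n = (if n \<ge> 0 then 0 else c (nat (- n - 1)))" for c n
    unfolding neg_def by (subst Pdo_inverse) (auto intro: exI[of _ "0::int"])
  let ?Y = "neg (right_inv_coeff f)" and ?Z = "neg (left_inv_coeff f)"
  have R: "factor f \<odot> ?Y = pone"
  proof (rule pdo_eqI)
    fix n
    consider "n > 0" | "n = 0" | k where "n = - int (Suc k)"
      by (rule int_neg_cases)
    then show "pcoeff (factor f \<odot> ?Y) n = pcoeff pone n"
    proof cases
      case (3 k)
      have "nat (- n - 1) = k" "nat (- (n - 1) - 1) = Suc k" using 3 by auto
      with 3 show ?thesis
        by (simp add: pcoeff_factor_left neg pone.rep_eq opone_def shift_shift[OF q_nonzero] shift_zero_int
            del: of_nat_Suc)
    qed (auto simp: pcoeff_factor_left neg pone.rep_eq opone_def shift_0 shift_one)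
  qed
  have L: "?Z \<odot> factor f = pone"
  proof (rule pdo_eqI)
    fix n
    consider "n > 0" | "n = 0" | k where "n = - int (Suc k)"
      by (rule int_neg_cases)
    then show "pcoeff (?Z \<odot> factor f) n = pcoeff pone n"
    proof cases
      case (3 k)
      have "nat (- n - 1) = k" "nat (- (n - 1) - 1) = Suc k" using 3 by auto
      with 3 show ?thesis
        by (simp add: pcoeff_factor_right neg pone.rep_eq opone_def del: of_nat_Suc)
    qed (auto simp: pcoeff_factor_right neg pone.rep_eq opone_def)
  qed
  \<comment> \<open>Associativity identifies the two one-sided inverses.\<close>
  have "?Z = ?Z \<odot> (factor f \<odot> ?Y)" by (simp add: R)
  also have "\<dots> = ?Y" by (simp only: pdo.mult.assoc[symmetric] L pdo.mult_1_left)
  finally have "?Y \<odot> factor f = pone" using L by simp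
  moreover have "monic (- 1) ?Y" by (simp add: monic_def ord_le_def neg)
  ultimately show ?thesis using R by blast
qed

lemma conj_power:
  assumes "A \<odot> B = pone" and BA: "B \<odot> A = pone"
  shows "(B \<odot> C \<odot> A) ^^^ n = B \<odot> C ^^^ n \<odot> A"
proof (induction n)
  case (Suc n)
  have "(B \<odot> C \<odot> A) ^^^ Suc n = B \<odot> C \<odot> (A \<odot> B) \<odot> C ^^^ n \<odot> A"
    unfolding pdo.power_Suc[of _ n] Suc by (simp only: pdo.mult.assoc)
  then show ?case by (simp add: assms pdo.mult.assoc)
qed (simp add: BA)

text \<open>Cyclicity of the trace moves the differentiated factor to the end of each Leibniz term.
  The general \<open>Z\<close> lets the induction absorb a factor \<open>A\<close>, and later
  carries an inverse of \<open>L_i\<close>.\<close>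

lemma tr_pevol_power:
  assumes "Z \<odot> A = A \<odot> Z"
  shows "tr (Z \<odot> pevol N g (A ^^^ Suc n)) = of_nat (Suc n) * tr (Z \<odot> A ^^^ n \<odot> pevol N g A)"
  using assms
proof (induction n arbitrary: Z)
  case 0
  then show ?case by simp
next
  case (Suc n)
  have ZA: "Z \<odot> A \<odot> A = A \<odot> (Z \<odot> A)" by (metis Suc.prems pdo.mult.assoc)
  have Zp: "A ^^^ k \<odot> Z = Z \<odot> A ^^^ k" for k
    by (induction k) (simp, metis Suc.prems pdo.mult.assoc pdo.power_Suc)
  have "tr (Z \<odot> pevol N g (A ^^^ Suc (Suc n))) =
      tr (Z \<odot> (pevol N g A \<odot> A ^^^ Suc n)) + tr (Z \<odot> A \<odot> pevol N g (A ^^^ Suc n))"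
    by (simp only: pdo.power_Suc[of A "Suc n"] pevol_pmul pdo.distrib_left tr_add pdo.mult.assoc)
  also have "tr (Z \<odot> (pevol N g A \<odot> A ^^^ Suc n)) = tr (Z \<odot> A ^^^ Suc n \<odot> pevol N g A)"
    by (simp only: pdo.mult.assoc[symmetric] tr_commute[OF q_nonzero, of _ "A ^^^ Suc n"] Zp)
  also have "tr (Z \<odot> A \<odot> pevol N g (A ^^^ Suc n)) =
      of_nat (Suc n) * tr (Z \<odot> A ^^^ Suc n \<odot> pevol N g A)"
    unfolding Suc.IH[OF ZA] by (simp only: pdo.power_Suc pdo.mult.assoc)
  finally show ?case
    by (simp only: of_nat_Suc[of "Suc n"] distrib_right mult_1_left)
qed

end

section \<open>The factorization of \<open>L_i\<close> and its root \<open>P_i\<close>\<close>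

context generic_q
begin

lemma N_pos: "1 \<le> N" using N_ge_2 by simp

definition X :: "nat \<Rightarrow> pdo" where
  "X i = factor (Lam (wrap N i))"

definition Y :: "nat \<Rightarrow> pdo" where
  "Y i = (SOME A. X i \<odot> A = pone \<and> A \<odot> X i = pone \<and> monic (- 1) A)"

lemma XY: "X i \<odot> Y i = pone" and YX: "Y i \<odot> X i = pone" and monic_Y: "monic (- 1) (Y i)"
proof -
  have "X i \<odot> Y i = pone \<and> Y i \<odot> X i = pone \<and> monic (- 1) (Y i)"
    unfolding Y_def X_def by (rule someI_ex) (rule factor_invertible)
  then show "X i \<odot> Y i = pone" "Y i \<odot> X i = pone" "monic (- 1) (Y i)" by auto
qed

lemma XY_cancel: "X i \<odot> (Y i \<odot> A) = A" and YX_cancel: "Y i \<odot> (X i \<odot> A) = A"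
  by (simp_all only: pdo.mult.assoc[symmetric] XY YX pdo.mult_1_left)

lemma pcoeff_X: "pcoeff (X i) = Dminus (wrap N i)"
  by (auto simp: fun_eq_iff X_def factor_def minus_pdo.rep_eq pcoeff_psingle Dminus_def)

primrec Xprod :: "nat \<Rightarrow> nat \<Rightarrow> pdo" where
  "Xprod i 0 = pone"
| "Xprod i (Suc k) = X i \<odot> Xprod (Suc i) k"

primrec Yprod :: "nat \<Rightarrow> nat \<Rightarrow> pdo" where
  "Yprod i 0 = pone"
| "Yprod i (Suc k) = Yprod (Suc i) k \<odot> Y i"

text \<open>Splitting off the last factor instead of the first is what exhibits the rotation of the
  factors.\<close>

lemma Xprod_Suc: "Xprod i (Suc k) = Xprod i k \<odot> X (i + k)"
proof (induction k arbitrary: i)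
  case (Suc k)
  have "Xprod i (Suc (Suc k)) = X i \<odot> Xprod (Suc i) (Suc k)" by (rule Xprod.simps)
  also have "\<dots> = (X i \<odot> Xprod (Suc i) k) \<odot> X (i + Suc k)"
    unfolding Suc by (simp add: pdo.mult.assoc)
  finally show ?case by simp
qed simp

lemma Xprod_Yprod: "Xprod i k \<odot> Yprod i k = pone"
proof (induction k arbitrary: i)
  case (Suc k)
  have "Xprod i (Suc k) \<odot> Yprod i (Suc k) = X i \<odot> (Xprod (Suc i) k \<odot> Yprod (Suc i) k) \<odot> Y i"
    by (simp add: pdo.mult.assoc)
  then show ?case by (simp add: Suc XY)
qed simp

lemma Yprod_Xprod: "Yprod i k \<odot> Xprod i k = pone"
proof (induction k arbitrary: i)
  case (Suc k)
  have "Yprod i (Suc k) \<odot> Xprod i (Suc k) = Yprod (Suc i) k \<odot> (Y i \<odot> X i) \<odot> Xprod (Suc i) k"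
    by (simp add: pdo.mult.assoc)
  then show ?case by (simp add: Suc YX)
qed simp

lemma monic_Xprod: "monic (int k) (Xprod i k)"
  by (induction k arbitrary: i) (auto simp: monic_pone X_def intro: monic_pmul monic_factor)

lemma J_Xprod: "pcoeff (Xprod i k) n \<in> J q N"
proof (induction k arbitrary: i n)
  case (Suc k)
  have "pcoeff (X i) n \<in> J q N" for n
    using J_uminus[OF J_Lam, of "wrap N i" N] wrap_bounds[OF N_pos, of i]
    by (simp add: pcoeff_X Dminus_def J_0 J_1)
  then show ?case unfolding Xprod.simps by (rule J_pmul) (rule Suc)
qed (simp add: J_pone)

lemma pcoeff_Xprod:
  "pcoeff (Xprod i k) = foldr (dmult q) (map (\<lambda>l. Dminus (wrap N (i + l))) [0..<k]) opone"
  by (induction k arbitrary: i)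
    (simp_all add: pone.rep_eq pmul.rep_eq pcoeff_X map_upt_Suc del: upt_Suc)

lemma pcoeff_Lop: "pcoeff (Xprod i N) = Lop q N i"
  by (simp add: pcoeff_Xprod Lop_def)

definition P :: "nat \<Rightarrow> pdo" where
  "P i = Pdo (Pop q N i)"

text \<open>Justifies the definite description in \<open>Pop\<close>: \<open>root_exists\<close>
  supplies a root with coefficients in \<open>J\<close>, and \<open>root_unique\<close> excludes any
  other.\<close>

lemma P_root: "monic 1 (P i)" "P i ^^^ N = Xprod i N" "pcoeff (P i) = Pop q N i"
proof -
  obtain A where A: "monic 1 A" "\<And>n. pcoeff A n \<in> J q N" "A ^^^ N = Xprod i N"
    using root_exists[OF monic_Xprod J_Xprod] by blast
  have "Pop q N i = pcoeff A"
    unfolding Pop_def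
  proof (rule the_equality)
    show "pcoeff A \<in> Iop q N \<and> pcoeff A 1 = 1 \<and> (\<forall>n>1. pcoeff A n = 0) \<and> dpow q (pcoeff A) N = Lop q N i"
      using A pcoeff[of A]
      by (auto simp: Iop_def monic_def ord_le_def pcoeff_power[symmetric] pcoeff_Lop)
  next
    fix R assume R: "R \<in> Iop q N \<and> R 1 = 1 \<and> (\<forall>n>1. R n = 0) \<and> dpow q R N = Lop q N i"
    then have r: "pcoeff (Pdo R) = R" by (intro Pdo_inverse) auto
    have "Pdo R = A"
    proof (rule root_unique)
      show "monic 1 (Pdo R)" using R by (simp add: monic_def ord_le_def r)
      show "Pdo R ^^^ N = A ^^^ N"
        using R by (intro pdo_eqI) (simp add: A(3) pcoeff_power pcoeff_Lop r)
    qed (rule A(1))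
    with r show "R = pcoeff A" by simp
  qed
  then have "P i = A" by (simp add: P_def pcoeff_inverse)
  with A \<open>Pop q N i = pcoeff A\<close> show "monic 1 (P i)" "P i ^^^ N = Xprod i N" "pcoeff (P i) = Pop q N i"
    by auto
qed

lemma X_wrap: "X (wrap N i) = X i"
  using wrap_add[OF N_pos, of i 0] by (simp add: X_def)

lemma P_wrap: "P (wrap N i) = P i"
  by (simp add: P_def Pop_def Lop_def wrap_add[OF N_pos])

text \<open>
  \<open>X\<^sub>i P\<^sub>i\<^sub>+\<^sub>1 X\<^sub>i\<^sup>-\<^sup>1\<close> is another monic root of \<open>L\<^sub>i\<close>, because conjugation by \<open>X\<^sub>i\<close> rotates the factors
  of \<open>L\<^sub>i\<^sub>+\<^sub>1\<close>.
\<close>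

lemma P_eq_conj: "P i = X i \<odot> P (Suc i) \<odot> Y i"
proof (rule root_unique)
  show "monic 1 (P i)" by (rule P_root)
  show "monic 1 (X i \<odot> P (Suc i) \<odot> Y i)"
    using monic_pmul[OF monic_pmul[OF monic_factor P_root(1)] monic_Y] by (simp add: X_def)
  have "X i \<odot> Xprod (Suc i) N = Xprod i N \<odot> X (i + N)"
    using Xprod_Suc[of i N] by simp
  also have "X (i + N) = X i" by (simp add: X_def wrap_period[OF N_pos])
  finally have "X i \<odot> Xprod (Suc i) N \<odot> Y i = Xprod i N" by (simp add: pdo.mult.assoc XY)
  then show "P i ^^^ N = (X i \<odot> P (Suc i) \<odot> Y i) ^^^ N"
    by (simp add: conj_power[OF YX XY] P_root)
qed

lemma Y_wrap: "Y (wrap N i) = Y i"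
  by (simp add: Y_def X_wrap)

lemma P_power_eq_conj: "P i ^^^ n = X i \<odot> P (Suc i) ^^^ n \<odot> Y i"
  by (subst P_eq_conj) (rule conj_power[OF YX XY])

lemma YP: "Y i \<odot> P i ^^^ n = P (Suc i) ^^^ n \<odot> Y i"
  by (subst P_power_eq_conj) (simp only: YX_cancel pdo.mult.assoc)

text \<open>Minus the variational derivative of \<open>Hn q N n\<close>, as \<open>vder_Hn\<close>
  will show; the sign comes from \<open>D - \<Lambda>_i\<close>.\<close>

definition grad :: "nat \<Rightarrow> nat \<Rightarrow> fser" where
  "grad n i = pcoeff (Y i \<odot> P i ^^^ n) 0"

lemma grad_wrap: "grad n (wrap N i) = grad n i"
  by (simp add: grad_def Y_wrap P_wrap)

lemma pevol_X: "pevol N g (X i) = psingle 0 (- g (wrap N i))"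
  using wrap_bounds[OF N_pos, of i]
  by (intro pdo_eqI)
    (auto simp: pcoeff_pevol pcoeff_X Dminus_def pcoeff_psingle evol_one evol_zero evol_uminus evol_Lam_general)

text \<open>The derivative hits one factor at a time. Conjugation by \<open>X i\<close> removes the
  first factor and turns \<open>P i\<close> into \<open>P (Suc i)\<close>, so the remaining terms
  form the same trace at \<open>Suc i\<close>.\<close>

lemma tr_pevol_Xprod:
  "tr (P i ^^^ n \<odot> pevol N g (Xprod i k) \<odot> Yprod i k) =
     - (\<Sum>l<k. fint (grad n (wrap N (i + l)) * g (wrap N (i + l))))"
proof (induction k arbitrary: i)
  case 0
  then show ?case by (simp add: pevol_pone tr_def Res_def pcoeff_simps fint_zero)
next
  case (Suc k)
  let ?X' = "Xprod (Suc i) k" and ?Y' = "Yprod (Suc i) k"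
  have "tr (P i ^^^ n \<odot> pevol N g (Xprod i (Suc k)) \<odot> Yprod i (Suc k)) =
      tr (P i ^^^ n \<odot> pevol N g (X i) \<odot> (?X' \<odot> ?Y') \<odot> Y i) +
      tr (P i ^^^ n \<odot> X i \<odot> pevol N g ?X' \<odot> ?Y' \<odot> Y i)"
    by (simp only: Xprod.simps Yprod.simps pevol_pmul pdo.distrib_left pdo.distrib_right tr_add pdo.mult.assoc)
  also have "tr (P i ^^^ n \<odot> pevol N g (X i) \<odot> (?X' \<odot> ?Y') \<odot> Y i) = tr (Y i \<odot> P i ^^^ n \<odot> pevol N g (X i))"
    unfolding Xprod_Yprod pdo.mult_1_right
    by (subst tr_commute[OF q_nonzero, of _ "Y i"]) (simp only: pdo.mult.assoc)
  also have "\<dots> = - fint (grad n (wrap N i) * g (wrap N i))"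
    by (simp add: pevol_X tr_def Res_def pcoeff_pmul_psingle shift_zero_int grad_wrap fint_uminus)
      (simp add: grad_def)
  also have "tr (P i ^^^ n \<odot> X i \<odot> pevol N g ?X' \<odot> ?Y' \<odot> Y i) =
      tr (Y i \<odot> P i ^^^ n \<odot> X i \<odot> pevol N g ?X' \<odot> ?Y')"
    by (subst tr_commute[OF q_nonzero, of _ "Y i"]) (simp only: pdo.mult.assoc)
  also have "Y i \<odot> P i ^^^ n \<odot> X i = P (Suc i) ^^^ n"
    by (simp add: YP pdo.mult.assoc YX)
  finally show ?case unfolding Suc sum.lessThan_Suc_shift by simp
qed

lemma P_Yprod: "P i \<odot> Yprod i N = Yprod i N \<odot> P i"
proof -
  have "P i \<odot> Xprod i N = Xprod i N \<odot> P i"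
    by (simp only: P_root(2)[symmetric] pdo.power_commutes)
  then have "Yprod i N \<odot> (P i \<odot> Xprod i N) \<odot> Yprod i N = Yprod i N \<odot> (Xprod i N \<odot> P i) \<odot> Yprod i N"
    by simp
  then have "Yprod i N \<odot> P i \<odot> (Xprod i N \<odot> Yprod i N) = (Yprod i N \<odot> Xprod i N) \<odot> P i \<odot> Yprod i N"
    by (simp only: pdo.mult.assoc)
  then show ?thesis by (simp add: Xprod_Yprod Yprod_Xprod)
qed

text \<open>The root is varied through \<open>L_i\<close>: with \<open>Z = P_i^n L_i^(-1)\<close>,
  the variation of \<open>P_i^N = L_i\<close> paired with \<open>Z\<close> is \<open>N\<close> times
  that of \<open>P_i\<close> paired with \<open>P_i^(n-1)\<close>. The factor \<open>N\<close> is
  kept on the left to avoid division.\<close>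

lemma tr_pevol_P_power:
  assumes "1 \<le> n" "1 \<le> i"
  shows "of_nat N * tr (pevol N g (P i ^^^ n)) = - of_nat n * (\<Sum>j=1..N. fint (grad n j * g j))"
proof -
  obtain n' where n: "n = Suc n'" using assms(1) by (cases n) auto
  obtain N' where N': "N = Suc N'" using N_pos by (cases N) auto
  let ?M = "Yprod i N"
  have MP: "?M \<odot> P i ^^^ k = P i ^^^ k \<odot> ?M" for k
  proof (induction k)
    case (Suc k)
    have "?M \<odot> P i ^^^ Suc k = (P i \<odot> ?M) \<odot> P i ^^^ k"
      by (simp only: pdo.power_Suc pdo.mult.assoc[symmetric] P_Yprod)
    also have "\<dots> = P i ^^^ Suc k \<odot> ?M"
      by (simp only: pdo.power_Suc pdo.mult.assoc Suc)
    finally show ?case .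
  qed simp
  \<comment> \<open>Since \<open>?M\<close> inverts the \<open>N\<close>-th power of
    \<open>P i\<close>, this product stands for the power \<open>n - 1\<close>, also when
    \<open>n < N\<close>.\<close>
  have "P i ^^^ n \<odot> ?M \<odot> P i ^^^ N' = P i ^^^ n' \<odot> (P i ^^^ N \<odot> ?M)"
  proof -
    have "P i ^^^ n \<odot> ?M \<odot> P i ^^^ N' = P i ^^^ (n + N') \<odot> ?M"
      by (simp only: MP pdo.mult.assoc pdo.power_add)
    moreover have "n + N' = n' + N" by (simp add: n N')
    ultimately show ?thesis by (simp only: pdo.power_add pdo.mult.assoc)
  qed
  then have nM: "P i ^^^ n \<odot> ?M \<odot> P i ^^^ N' = P i ^^^ n'"
    by (simp add: P_root(2) Xprod_Yprod)
  have comm: "(P i ^^^ n \<odot> ?M) \<odot> P i = P i \<odot> (P i ^^^ n \<odot> ?M)"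
  proof -
    have "(P i ^^^ n \<odot> ?M) \<odot> P i = P i ^^^ n \<odot> (P i \<odot> ?M)"
      by (simp only: pdo.mult.assoc P_Yprod)
    also have "\<dots> = (P i ^^^ n \<odot> P i) \<odot> ?M" by (simp only: pdo.mult.assoc)
    also have "\<dots> = (P i \<odot> P i ^^^ n) \<odot> ?M" by (simp only: pdo.power_commutes)
    finally show ?thesis by (simp only: pdo.mult.assoc)
  qed
  have "of_nat N * tr (P i ^^^ n' \<odot> pevol N g (P i)) = tr (P i ^^^ n \<odot> ?M \<odot> pevol N g (Xprod i N))"
    using tr_pevol_power[OF comm, of N g N'] by (simp only: nM N'[symmetric] P_root(2))
  also have "\<dots> = tr (P i ^^^ n \<odot> pevol N g (Xprod i N) \<odot> ?M)"
    by (simp only: MP[symmetric] pdo.mult.assoc tr_commute[OF q_nonzero, of ?M])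
  also have "\<dots> = - (\<Sum>j=1..N. fint (grad n j * g j))"
    unfolding tr_pevol_Xprod using sum_wrap[OF N_pos assms(2), of "\<lambda>j. fint (grad n j * g j)"] by simp
  finally have N: "of_nat N * tr (P i ^^^ n' \<odot> pevol N g (P i)) = - (\<Sum>j=1..N. fint (grad n j * g j))" .
  \<comment> \<open>Second use of the power rule, now with \<open>Z\<close> the identity.\<close>
  have "tr (pevol N g (P i ^^^ n)) = of_nat n * tr (P i ^^^ n' \<odot> pevol N g (P i))"
    using tr_pevol_power[of pone "P i" N g n'] by (simp add: n)
  then have "of_nat N * tr (pevol N g (P i ^^^ n)) = of_nat n * (of_nat N * tr (P i ^^^ n' \<odot> pevol N g (P i)))"
    by (simp only: mult.left_commute)
  then show ?thesis by (simp only: N mult_minus_left mult_minus_right)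
qed

end

section \<open>The bracket with the Toda hamiltonian\<close>

lemma qint_add_difference: "qint q (X + (qshift q T - T)) = qint q X"
proof -
  have "X + (qshift q T - T) + (qshift q S - S) = X + (qshift q (T + S) - (T + S))" for S
    by (simp add: qshift_add)
  moreover have "X + (qshift q S - S) = X + (qshift q T - T) + (qshift q (S - T) - (S - T))" for S
    by (simp add: qshift_diff)
  ultimately show ?thesis unfolding qint_def by (metis (mono_tags, lifting))
qed

lemma qint_self: "X \<in> qint q X"
proof -
  have "qshift q 0 = 0" using qshift_diff[of q 0 0] by simp
  then have "X = X + (qshift q 0 - 0)" by simp
  then show ?thesis unfolding qint_def by blast
qed

text \<open>Two densities of one class differ by \<open>D T - T\<close>, and \<open>hamder\<close>
  commutes with \<open>D\<close>; hence the union in \<open>bracket\<close> is a single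
  class.\<close>

lemma bracket_qint:
  assumes "q \<noteq> 0" "X \<in> Jplus q N"
  shows "bracket q N F (qint q X) = qint q (hamder q N F X)"
proof -
  have "qint q (hamder q N F Z) = qint q (hamder q N F X)" if "qint q Z = qint q X" for Z
  proof -
    have "Z \<in> qint q X" using qint_self[of Z q] that by simp
    then obtain T where Z: "Z = X + (qshift q T - T)" by (auto simp: qint_def)
    show ?thesis
      unfolding Z hamder_add hamder_diff hamder_qshift[OF assms(1)] by (rule qint_add_difference)
  qed
  then show ?thesis unfolding bracket_def using assms(2) by blast
qed

lemma Lampow_single: "Lampow (Poly_Mapping.single j (- 1)) = minv (Lam j)"
  by (simp add: Lampow_def)

lemma Lampow_ratio:
  assumes "i \<noteq> j"
  shows "Lampow (Poly_Mapping.single i 1 + Poly_Mapping.single j (- 1)) = Lam i * minv (Lam j)"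
proof -
  let ?a = "Poly_Mapping.single i 1 + Poly_Mapping.single j (- 1) :: nat \<Rightarrow>\<^sub>0 int"
  have l: "Poly_Mapping.lookup ?a k = (if k = i then 1 else if k = j then - 1 else 0)" for k
    using assms by (simp add: lookup_add lookup_single when_def)
  then have "Poly_Mapping.keys ?a = {i, j}"
    using assms by (auto simp: in_keys_iff split: if_splits)
  then show ?thesis unfolding Lampow_def using assms by (simp add: l)
qed

lemma qshift_single: "qshift q (Poly_Mapping.single \<alpha> f) = Poly_Mapping.single \<alpha> (shift q 1 f * Lampow \<alpha>)"
  by (rule poly_mapping_eqI) (simp add: lookup_qshift lookup_single when_def shift_0)

lemma Toda_density:
  "Qpow i 1 * qshift q (Qpow j (- 1)) =
     Poly_Mapping.single (Poly_Mapping.single i 1 + Poly_Mapping.single j (- 1)) (minv (Lam j))"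
  by (simp add: Qpow_def qshift_single shift_one Lampow_single mult_single)

text \<open>Logarithmic derivatives add: \<open>Q_i\<close> gives \<open>Qrate i\<close>,
  \<open>Q_j^(-1)\<close> gives \<open>- Qrate j\<close>, and \<open>\<Lambda>_j^(-1)\<close> gives
  \<open>Qrate j - D Qrate j\<close>.\<close>

lemma hamder_Toda_density:
  assumes "i \<in> {1..N}" "j \<in> {1..N}" "i \<noteq> j"
  shows "hamder q N F (Poly_Mapping.single (Poly_Mapping.single i 1 + Poly_Mapping.single j (- 1)) (minv (Lam j))) =
    Poly_Mapping.single (Poly_Mapping.single i 1 + Poly_Mapping.single j (- 1))
      ((Qrate q N F i - shift q 1 (Qrate q N F j)) * minv (Lam j))"
proof -
  let ?Q = "Qrate q N F"
  let ?a = "Poly_Mapping.single i 1 + Poly_Mapping.single j (- 1) :: nat \<Rightarrow>\<^sub>0 int"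
  have "(\<Sum>k=1..N. of_int (Poly_Mapping.lookup ?a k) * ?Q k) =
      (\<Sum>k=1..N. (if k = i then ?Q i else 0) - (if k = j then ?Q j else 0))"
    using assms(3) by (intro sum.cong) (auto simp: lookup_add lookup_single when_def)
  also have "\<dots> = ?Q i - ?Q j" using assms by (simp add: sum_subtractf)
  finally have w: "(\<Sum>k=1..N. of_int (Poly_Mapping.lookup ?a k) * ?Q k) = ?Q i - ?Q j" .
  have "evol N (Lamrate q N F) (Lam j) * minv (Lam j) = shift q 1 (?Q j) - ?Q j"
    using assms(2) Lam_Lamrate[of j q N F] by (simp add: evol_Lam mult.commute)
  then have "evol N (Lamrate q N F) (minv (Lam j)) = - (shift q 1 (?Q j) - ?Q j) * minv (Lam j)"
    by (simp add: evol_minv_Lam)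
  moreover have "- (shift q 1 (?Q j) - ?Q j) * minv (Lam j) + (?Q i - ?Q j) * minv (Lam j) =
      (?Q i - shift q 1 (?Q j)) * minv (Lam j)"
    unfolding distrib_right[symmetric] by simp
  ultimately have "evol N (Lamrate q N F) (minv (Lam j)) +
      (\<Sum>k=1..N. of_int (Poly_Mapping.lookup ?a k) * ?Q k) * minv (Lam j) =
      (?Q i - shift q 1 (?Q j)) * minv (Lam j)"
    unfolding w by simp
  then show ?thesis
    by (intro poly_mapping_eqI) (auto simp: lookup_hamder lookup_single when_def evol_zero)
qed

section \<open>Telescoping, variational derivatives and total differences\<close>

context generic_q
begin

text \<open>The closed-form constants of the bracket are chosen so that these differences are local.\<close>

lemma kern_telescope:
  assumes i: "i \<in> {1..N}" and j: "j \<in> {1..N}"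
  shows "kern q N i j m - q powi m * kern q N i (wrap N (j + 1)) m =
    (if i = wrap N (j + 1) then 1 else 0) - (if i = j then 1 else 0)"
proof -
  define x where "x = q powi m"
  have E: "q powi (m * (a + b)) = q powi (m * a) * q powi (m * b)" for a b
    using q_nonzero by (simp add: distrib_left power_int_add)
  define j' where "j' = wrap N (j + 1)"
  have j': "j < N \<and> j' = j + 1 \<or> j = N \<and> j' = 1"
    using j wrap_id[of "j + 1" N] wrap_period[OF N_pos, of 1] wrap_id[of 1 N] N_pos
    by (cases "j < N") (auto simp: j'_def add.commute)
  define r where "r = (if m = 0 then 1 / of_nat N else (1 - x) / (1 - q powi (m * int N)))"
  define e where "e = q powi (m * (int N - 1))"
  have eN: "q powi (m * int N) = e * x"
    using E[of "int N - 1" 1] by (simp add: e_def x_def)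
  have nz: "1 - e * x \<noteq> 0" if "m \<noteq> 0"
    using q_powi_neq_1[of "m * int N"] that N_pos by (simp add: eN)
  \<comment> \<open>The two identities treat the steps from \<open>j\<close> to \<open>j + 1\<close>
    that leave and enter the diagonal; elsewhere consecutive constants differ exactly by the factor
    \<open>x\<close>.\<close>
  have diag: "kern q N k k m - e * r = - 1 \<and> r - x * kern q N k k m = 1" for k
  proof (cases "m = 0")
    case True
    then show ?thesis using N_pos by (simp add: kern_def r_def e_def x_def field_simps)
  next
    case False
    have k: "kern q N k k m = - ((1 - e) / (1 - e * x))" and r: "r = (1 - x) / (1 - e * x)"
      using False by (simp_all add: kern_def r_def eN e_def[symmetric])
    show ?thesis unfolding k r using nz[OF False] by (simp add: divide_simps) (simp add: algebra_simps)
  qed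
  have less: "kern q N k l m = q powi (m * (int N + int k - int l - 1)) * r" if "k < l" for k l
    using that by (simp add: kern_def r_def x_def)
  have gr: "kern q N k l m = q powi (m * (int k - int l - 1)) * r" if "l < k" for k l
    using that by (simp add: kern_def r_def x_def)
  have X: "x * q powi (m * a) = q powi (m * (a + 1))" for a
    using E[of a 1] by (simp add: x_def mult.commute)
  have Xr: "x * (q powi (m * a) * r) = q powi (m * (a + 1)) * r" for a
    by (simp only: X[symmetric] mult.assoc)
  have jj': "j \<noteq> j'" using j' N_ge_2 by auto
  consider "i = j" | "i = j'" | "i \<noteq> j" "i \<noteq> j'" by blast
  then have "kern q N i j m - x * kern q N i j' m = (if i = j' then 1 else 0) - (if i = j then 1 else 0)"
  proof cases
    case 1
    have "x * kern q N j j' m = e * r"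
      using j'
    proof
      assume "j < N \<and> j' = j + 1"
      then show ?thesis by (simp add: less Xr e_def)
    next
      assume "j = N \<and> j' = 1"
      then show ?thesis using N_ge_2 by (simp add: gr Xr e_def)
    qed
    with 1 jj' diag show ?thesis by simp
  next
    case 2
    have "kern q N j' j m = r"
      using j' by (rule disjE) (use N_ge_2 in \<open>auto simp: less gr\<close>)
    with 2 jj' diag show ?thesis by simp
  next
    case 3
    have "kern q N i j m = x * kern q N i j' m"
      using j'
    proof
      assume *: "j < N \<and> j' = j + 1"
      show ?thesis
      proof (cases "i < j")
        case True
        with * have "int N + int i - int j' - 1 + 1 = int N + int i - int j - 1" "i < j'" by auto
        with True show ?thesis by (simp only: less Xr)
      next
        case False
        with * 3 have "j < i" "j' < i" by auto
        with * show ?thesis by (simp add: gr Xr)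
      qed
    next
      assume *: "j = N \<and> j' = 1"
      with 3 i have "i < j" "j' < i" by auto
      with * show ?thesis by (simp add: gr less Xr)
    qed
    with 3 show ?thesis by simp
  qed
  then show ?thesis by (simp add: x_def j'_def)
qed

text \<open>On each Fourier mode \<open>kern_telescope\<close> reduces the nonlocal multipliers to
  Kronecker deltas.\<close>

lemma Qrate_telescope:
  assumes j: "j \<in> {1..N}"
  defines "j' \<equiv> wrap N (j + 1)"
  shows "Qrate q N F j - shift q 1 (Qrate q N F j') = vder j' F * Lam j' - vder j F * Lam j"
proof -
  let ?u = "\<lambda>i. vder i F * Lam i"
  have j': "j' \<in> {1..N}" using wrap_bounds[OF N_pos] by (auto simp: j'_def)
  have "fmul (kern q N i j) f - shift q 1 (fmul (kern q N i j') f) =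
      (if i = j' then f else 0) - (if i = j then f else 0)" if "i \<in> {1..N}" for i f
  proof (rule mps_eqI)
    fix M
    let ?m = "zexp M"
    have "mcoeff (fmul (kern q N i j) f - shift q 1 (fmul (kern q N i j') f)) M =
        lconst (kern q N i j ?m - q powi ?m * kern q N i j' ?m) * mcoeff f M"
      by (simp add: minus_mps.rep_eq mcoeff_shift mcoeff_fmul lconst_diff lconst_mult[symmetric]
          left_diff_distrib mult.assoc)
    also have "\<dots> = mcoeff ((if i = j' then f else 0) - (if i = j then f else 0)) M"
      unfolding j'_def kern_telescope[OF that j] lconst_diff
      by (auto simp: minus_mps.rep_eq zero_mps.rep_eq lconst_1 lconst_def left_diff_distrib)
    finally show "mcoeff (fmul (kern q N i j) f - shift q 1 (fmul (kern q N i j') f)) M =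
      mcoeff ((if i = j' then f else 0) - (if i = j then f else 0)) M" .
  qed
  then have "Qrate q N F j - shift q 1 (Qrate q N F j') =
      (\<Sum>i=1..N. (if i = j' then ?u i else 0) - (if i = j then ?u i else 0))"
    unfolding Qrate_def shift_sum sum_subtractf[symmetric] by (intro sum.cong) auto
  also have "\<dots> = ?u j' - ?u j" using j j' by (simp add: sum_subtractf)
  finally show ?thesis .
qed

text \<open>The first variation is computed twice, by \<open>fint_evol\<close> with
  \<open>vder\<close> and by \<open>tr_pevol_P_power\<close> with \<open>grad\<close>. Nondegeneracy
  of the pairing, tested on flows moving only \<open>Lam j\<close>, identifies the two.\<close>

lemma vder_Hn:
  assumes "1 \<le> n" "j \<in> {1..N}"
  shows "vder j (Hn q N n) = - grad n j"
proof -
  define R where "R = (\<Sum>i=1..N. Res (pcoeff (P i ^^^ n)))"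
  have H: "Hn q N n = fint (fconst (1 / of_nat n) * R)"
    unfolding Hn_def fint_fconst R_def Tr_def
    by (intro arg_cong2[of _ _ _ _ "(*)"] arg_cong[of _ _ fint] sum.cong refl)
      (simp add: mpow_diagm pcoeff_power P_root(3))
  have main: "fint (\<Sum>k=1..N. vder k (Hn q N n) * g k) = - (\<Sum>k=1..N. fint (grad n k * g k))" for g
  proof -
    let ?S = "\<Sum>k=1..N. fint (grad n k * g k)"
    have "fint (evol N g R) = (\<Sum>i=1..N. tr (pevol N g (P i ^^^ n)))"
      by (simp add: R_def evol_sum fint_sum tr_pevol)
    \<comment> \<open>All \<open>N\<close> diagonal entries contribute equally, which compensates
      the factor \<open>N\<close> on the left.\<close>
    then have "of_nat N * fint (evol N g R) = (\<Sum>i=1..N. - of_nat n * ?S)"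
      using tr_pevol_P_power[OF assms(1)] by (simp add: sum_distrib_left)
    also have "\<dots> = of_nat N * (- of_nat n * ?S)" by simp
    finally have "fint (evol N g R) = of_nat n * (- ?S)"
      using of_nat_cancel[of N] N_pos by simp
    then have "fint (evol N g (fconst (1 / of_nat n) * R)) = fconst (1 / of_nat n) * (of_nat n * (- ?S))"
      by (simp only: evol_fconst fint_fconst)
    also have "\<dots> = - ?S" using assms(1) by (simp only: fconst_of_nat_cancel)
    finally show ?thesis unfolding fint_evol H .
  qed
  have "vder j (Hn q N n) + grad n j = 0"
  proof (rule fint_pairing_nondegenerate)
    fix h
    have sel: "(\<Sum>k=1..N. G k (if k = j then h else 0)) = G j h" if "\<And>k. G k 0 = 0" for G :: "nat \<Rightarrow> fser \<Rightarrow> fser"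
    proof -
      have "(\<Sum>k=1..N. G k (if k = j then h else 0)) = (\<Sum>k=1..N. if k = j then G j h else 0)"
        using that by (intro sum.cong) auto
      then show ?thesis using assms(2) by simp
    qed
    have "fint (vder j (Hn q N n) * h) = - fint (grad n j * h)"
      using main[of "\<lambda>k. if k = j then h else 0"] sel[of "\<lambda>k y. vder k (Hn q N n) * y"]
        sel[of "\<lambda>k y. fint (grad n k * y)"] by (simp add: fint_zero)
    then show "fint ((vder j (Hn q N n) + grad n j) * h) = 0"
      by (simp add: distrib_right fint_add)
  qed
  then show ?thesis by (simp add: eq_neg_iff_add_eq_0)
qed

text \<open>
  Dividing \<open>P\<^sub>i\<^sub>+\<^sub>1\<^sup>n\<close> by \<open>X\<^sub>i\<^sub>+\<^sub>1\<close> on the left and by \<open>X\<^sub>i\<close> on the right gives one operator \<open>C\<close> whose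
  coefficients \<open>c = C\<^sub>0\<close> and \<open>t = C\<^sub>-\<^sub>1\<close> express two consecutive gradients.
\<close>

lemma grad_neighbours:
  obtains c t where
    "grad n i = shift q 1 t - Lam (wrap N (Suc i)) * c"
    "grad n (Suc i) = t - c * Lam (wrap N i)"
proof -
  define C where "C = Y (Suc i) \<odot> P (Suc i) ^^^ n \<odot> Y i"
  have "X (Suc i) \<odot> C = P (Suc i) ^^^ n \<odot> Y i"
    by (simp only: C_def pdo.mult.assoc XY_cancel)
  then have "Y i \<odot> P i ^^^ n = X (Suc i) \<odot> C" by (simp only: YP)
  then have 1: "grad n i = shift q 1 (pcoeff C (- 1)) - Lam (wrap N (Suc i)) * pcoeff C 0"
    by (simp add: grad_def X_def pcoeff_factor_left)
  have "Y (Suc i) \<odot> P (Suc i) ^^^ n = C \<odot> X i"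
    by (simp only: C_def pdo.mult.assoc YX pdo.mult_1_right)
  then have 2: "grad n (Suc i) = pcoeff C (- 1) - pcoeff C 0 * Lam (wrap N i)"
    by (simp add: grad_def X_def pcoeff_factor_right shift_zero_int)
  show thesis using that 1 2 by blast
qed

text \<open>Needed because the union in \<open>bracket\<close> ranges only over densities in
  \<open>Jplus\<close>.\<close>

lemma Toda_density_in_Jplus:
  "(\<Sum>i=1..N. Qpow i 1 * qshift q (Qpow (wrap N (i + 1)) (- 1))) \<in> Jplus q N"
proof -
  have zero: "0 \<in> Jplus q N"
    using Jplus_emb[OF J_0] by (simp add: emb_def)
  have sum: "sum f S \<in> Jplus q N" if "\<And>x. x \<in> S \<Longrightarrow> f x \<in> Jplus q N" for f :: "nat \<Rightarrow> qser" and S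
    using that by (induction S rule: infinite_finite_induct) (auto intro: zero Jplus_add)
  show ?thesis
    using wrap_bounds[OF N_pos] by (intro sum Jplus_mult Jplus_shift Jplus_Q) auto
qed

lemma hamder_Toda_summand:
  assumes n: "1 \<le> n" and j: "j \<in> {1..N}"
  shows "\<exists>T. hamder q N (Hn q N n) (Qpow j 1 * qshift q (Qpow (wrap N (j + 1)) (- 1))) = qshift q T - T"
proof -
  define j' where "j' = wrap N (j + 1)"
  have j': "j' \<in> {1..N}" using wrap_bounds[OF N_pos] by (auto simp: j'_def)
  \<comment> \<open>This is where \<open>N \<ge> 2\<close> enters: for \<open>N = 1\<close> the
    density would have no \<open>Q\<close> left.\<close>
  have "j' \<noteq> j"
  proof (cases "j < N")
    case True
    then show ?thesis by (simp add: j'_def wrap_id)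
  next
    case False
    then have "j = N" using j by simp
    then show ?thesis
      using wrap_period[OF N_pos, of 1] wrap_id[of 1 N] N_ge_2 by (simp add: j'_def add.commute)
  qed
  then have jj': "j \<noteq> j'" by simp
  obtain c t where ct: "grad n j = shift q 1 t - Lam j' * c" "grad n (Suc j) = t - c * Lam j"
    using grad_neighbours[of n j] wrap_id[of j N] j unfolding j'_def by (metis Suc_eq_plus1 atLeastAtMost_iff)
  have V: "vder j (Hn q N n) = Lam j' * c - shift q 1 t" "vder j' (Hn q N n) = c * Lam j - t"
    using vder_Hn[OF n j] vder_Hn[OF n j'] ct grad_wrap[of n "j + 1"] by (simp_all add: j'_def)
  \<comment> \<open>The terms in \<open>c\<close> cancel, and the factor left on
    \<open>shift q 1 t\<close> is the \<open>Lampow\<close> by which \<open>D\<close> acts on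
    \<open>Q_j Q_j'^(-1)\<close>.\<close>
  have "(vder j' (Hn q N n) * Lam j' - vder j (Hn q N n) * Lam j) * minv (Lam j') =
      shift q 1 t * (Lam j * minv (Lam j')) - t"
  proof -
    have "(vder j' (Hn q N n) * Lam j' - vder j (Hn q N n) * Lam j) * minv (Lam j') =
        (c * Lam j - t) * (Lam j' * minv (Lam j')) - (c * Lam j * (Lam j' * minv (Lam j')) -
           shift q 1 t * (Lam j * minv (Lam j')))"
      unfolding V by (simp only: left_diff_distrib right_diff_distrib mult_ac)
    then show ?thesis by (simp add: minv_Lam)
  qed
  then have "hamder q N (Hn q N n) (Qpow j 1 * qshift q (Qpow j' (- 1))) =
      qshift q (Poly_Mapping.single (Poly_Mapping.single j 1 + Poly_Mapping.single j' (- 1)) t) -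
      Poly_Mapping.single (Poly_Mapping.single j 1 + Poly_Mapping.single j' (- 1)) t"
    unfolding Toda_density hamder_Toda_density[OF j j' jj'] Qrate_telescope[OF j, folded j'_def]
      qshift_single Lampow_ratio[OF jj'] single_diff[symmetric] by simp
  then show ?thesis unfolding j'_def by blast
qed

lemma bracket_Hn_Htoda:
  assumes "1 \<le> n"
  shows "bracket q N (Hn q N n) (Htoda q N) = qint q 0"
proof -
  let ?d = "\<lambda>i. Qpow i 1 * qshift q (Qpow (wrap N (i + 1)) (- 1))"
  obtain T where T: "\<And>i. i \<in> {1..N} \<Longrightarrow> hamder q N (Hn q N n) (?d i) = qshift q (T i) - T i"
    using hamder_Toda_summand[OF assms] by metis
  have "hamder q N (Hn q N n) (\<Sum>i=1..N. ?d i) = 0 + (qshift q (\<Sum>i=1..N. T i) - (\<Sum>i=1..N. T i))"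
    unfolding hamder_sum qshift_sum sum_subtractf[symmetric] add_0 by (intro sum.cong refl T)
  then show ?thesis
    unfolding Htoda_def bracket_qint[OF q_nonzero Toda_density_in_Jplus]
    by (simp only: qint_add_difference)
qed

end

theorem theorem3:
  fixes q :: complex and N n :: nat
  assumes "q \<noteq> 0" and "\<And>k::nat. 1 \<le> k \<Longrightarrow> q ^ k \<noteq> 1"
    and "2 \<le> N" and "1 \<le> n"
  shows "bracket q N (Hn q N n) (Htoda q N) = qint q 0"
proof -
  interpret generic_q q N
    by unfold_locales (use assms in auto)
  show ?thesis by (rule bracket_Hn_Htoda[OF assms(4)])
qed

end
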